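(* Let $\lambda>0$ and let $n\ge2$ be an integer. Let $V^{(n)}$ be the multiple iterated Poisson process of order $n$ with intensity $\lambda$. Then its sojourn times $S_k^{(n)}$, $k\ge1$, are i.i.d. exponential random variables; more specifically, $$S_k^{(n)}\sim \mathrm{Exp}(\lambda q_{n-1})\quad\text{for all }k\ge1,$$ where $q_j=P(V_1^{(j)}>0)$ for $j\ge1$. The sequence $q_j$, $j\ge1$, satisfies the recursive relation $$q_j=1-e^{-\lambda q_{j-1}},\quad j\ge2,\qquad q_1=1-e^{-\lambda}.$$
   Context: Let $N^1,N^2,\dots$ be independent Poisson processes, all with the same intensity $\lambda>0$. The multiple iterated Poisson process (MIPP) is defined by $V_t^{(1)}=N_t^1$ and $V_t^{(m)}=N^m_{V_t^{(m-1)}}$ for $m\ge2$ (the process $N^m$ evaluated at time $V_t^{(m-1)}$). The jump times of $V^{(n)}$ are $J_0^{(n)}=0$ and $J_{k+1}^{(n)}=\inf\{t\ge J_k^{(n)}: V_t^{(n)}\ne V^{(n)}_{J_k^{(n)}}\}$ for $k\ge0$, with $\inf\emptyset=\infty$. The sojourn (holding) times are, for $k\ge1$, $S_k^{(n)}=J_k^{(n)}-J_{k-1}^{(n)}$ if $J_{k-1}^{(n)}<\infty$ and $S_k^{(n)}=\infty$ otherwise. $\mathrm{Exp}(r)$ denotes the exponential distribution with rate $r$ (mean $1/r$). *)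

theory Defs
  imports "HOL-Probability.Probability"
begin

text \<open>
  A Poisson process of intensity \<open>lam > 0\<close> is a counting process: all paths start at 0, are
  nondecreasing and right-continuous (\<open>nat\<close> carries the discrete topology), and the increments are
  independent and stationary with Poisson law. Only times \<open>t \<ge> 0\<close> matter. Since paths are
  nondecreasing, the truncated subtraction on \<open>nat\<close> agrees with the usual one.
\<close>

definition poisson_process :: "'a measure \<Rightarrow> real \<Rightarrow> (real \<Rightarrow> 'a \<Rightarrow> nat) \<Rightarrow> bool" where
  "poisson_process M lam X \<longleftrightarrow>
     (\<forall>t\<ge>0. X t \<in> measurable M (count_space UNIV)) \<and>
     (\<forall>\<omega>\<in>space M. X 0 \<omega> = 0) \<and>
     (\<forall>\<omega>\<in>space M. mono_on {0..} (\<lambda>t. X t \<omega>)) \<and>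
     (\<forall>\<omega>\<in>space M. \<forall>t\<ge>0. continuous (at_right t) (\<lambda>s. X s \<omega>)) \<and>
     (\<forall>(m::nat) (t::nat \<Rightarrow> real). 0 \<le> t 0 \<and> strict_mono t \<longrightarrow>
        prob_space.indep_vars M (\<lambda>_. count_space UNIV)
          (\<lambda>i \<omega>. X (t (Suc i)) \<omega> - X (t i) \<omega>) {..<m}) \<and>
     (\<forall>s\<ge>0. \<forall>h>0.
        distr M (count_space UNIV) (\<lambda>\<omega>. X (s + h) \<omega> - X s \<omega>)
          = measure_pmf (poisson_pmf (lam * h)))"

text \<open>
  Independence of the processes \<open>N i\<close>, \<open>i \<ge> 1\<close>, as random elements of the path space
  \<open>nat\<^bsup>[0,\<infinity>)\<^esup>\<close> with the product \<open>\<sigma>\<close>-algebra.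
\<close>

definition indep_processes :: "'a measure \<Rightarrow> (nat \<Rightarrow> real \<Rightarrow> 'a \<Rightarrow> nat) \<Rightarrow> bool" where
  "indep_processes M N \<longleftrightarrow>
     prob_space.indep_vars M (\<lambda>_. Pi\<^sub>M {0::real..} (\<lambda>_. count_space (UNIV :: nat set)))
       (\<lambda>i \<omega>. \<lambda>t\<in>{0..}. N i t \<omega>) {1..}"

text \<open>The order \<open>m\<close> ranges over \<open>m \<ge> 1\<close>; order \<open>0\<close> is left unspecified, and \<open>N 0\<close> is never used.\<close>

fun mipp :: "(nat \<Rightarrow> real \<Rightarrow> 'a \<Rightarrow> nat) \<Rightarrow> nat \<Rightarrow> real \<Rightarrow> 'a \<Rightarrow> nat" where
  "mipp N (Suc 0) t \<omega> = N (Suc 0) t \<omega>"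
| "mipp N (Suc (Suc m)) t \<omega> = N (Suc (Suc m)) (real (mipp N (Suc m) t \<omega>)) \<omega>"

text \<open>
  Jump and sojourn times of a process \<open>X\<close> take values in \<open>[0,\<infinity>]\<close>, with \<open>Inf {} = \<infinity>\<close> in \<open>ereal\<close>. If
  \<open>jump_time X k \<omega> = \<infinity>\<close> the set in the recursion is empty, so the value of
  \<open>real_of_ereal \<infinity>\<close> is irrelevant.
\<close>

primrec jump_time :: "(real \<Rightarrow> 'a \<Rightarrow> nat) \<Rightarrow> nat \<Rightarrow> 'a \<Rightarrow> ereal" where
  "jump_time X 0 \<omega> = 0"
| "jump_time X (Suc k) \<omega> =
     Inf {ereal t | t. jump_time X k \<omega> \<le> ereal t \<and> X t \<omega> \<noteq> X (real_of_ereal (jump_time X k \<omega>)) \<omega>}"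

text \<open>Sojourn times are indexed by \<open>k \<ge> 1\<close>.\<close>

definition sojourn_time :: "(real \<Rightarrow> 'a \<Rightarrow> nat) \<Rightarrow> nat \<Rightarrow> 'a \<Rightarrow> ereal" where
  "sojourn_time X k \<omega> =
     (if jump_time X (k - 1) \<omega> < \<infinity> then jump_time X k \<omega> - jump_time X (k - 1) \<omega> else \<infinity>)"

text \<open>The law \<open>Exp(r)\<close>, \<open>r > 0\<close>, as a measure on the extended reals (it gives no mass to \<open>\<infinity>\<close>).\<close>

definition exponential_law :: "real \<Rightarrow> ereal measure" where
  "exponential_law r = distr (density lborel (exponential_density r)) borel ereal"

definition mipp_pos_prob :: "'a measure \<Rightarrow> (nat \<Rightarrow> real \<Rightarrow> 'a \<Rightarrow> nat) \<Rightarrow> nat \<Rightarrow> real" where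
  "mipp_pos_prob M N j = measure M {\<omega> \<in> space M. mipp N j 1 \<omega> > 0}"

end

theory Submission
  imports Defs
begin

text \<open>
  A composition \<open>t \<mapsto> Y (X t)\<close> of independent nondecreasing right-continuous processes with values in
  the natural numbers and with stationary independent increments has stationary independent increments
  again, because conditionally on \<open>X\<close> the increments of the composition are increments of \<open>Y\<close>
  over intervals whose lengths are increments of \<open>X\<close>. Hence this holds for \<open>V\<^sup>n\<close>.
  For such a process with \<open>P(X\<^sub>s = 0) = exp (- r s)\<close>, the strong Markov property at the jump times gives
  \<open>P(S\<^sub>1 \<in> B\<^sub>1, \<dots>, S\<^sub>k \<in> B\<^sub>k, S\<^sub>k\<^sub>+\<^sub>1 > s) = P(S\<^sub>1 \<in> B\<^sub>1, \<dots>, S\<^sub>k \<in> B\<^sub>k) exp (- r s)\<close>,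
  so that the sojourn times are independent with law \<open>Exp(r)\<close>. With \<open>\<phi>(u) = exp (- \<lambda> (1 - u))\<close>, the generating
  function of \<open>V\<^sup>n\<^sub>s\<close> at \<open>u\<close> is \<open>exp (- \<lambda> s (1 - \<phi>\<^sup>n\<^sup>-\<^sup>1(u)))\<close>, where the power of \<open>\<phi>\<close> is an iterate.
  At \<open>u = 0\<close> this gives \<open>q\<^sub>n = 1 - \<phi>\<^sup>n(0)\<close>, hence the rate \<open>\<lambda> q\<^sub>n\<^sub>-\<^sub>1\<close> and the recursion.
\<close>

subsection \<open>Jump times of counting paths\<close>

text \<open>Right-continuity of a path with values in the discrete space of natural numbers means
  that it stays constant for a positive time after each \<open>t\<close>;
  \<open>X_right_const\<close> records it in this form.\<close>

locale counting_process =
  fixes M :: "'a measure" and X :: "real \<Rightarrow> 'a \<Rightarrow> nat"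
  assumes measurable_X: "0 \<le> t \<Longrightarrow> X t \<in> measurable M (count_space UNIV)"
    and X_zero: "\<omega> \<in> space M \<Longrightarrow> X 0 \<omega> = 0"
    and X_mono: "\<omega> \<in> space M \<Longrightarrow> 0 \<le> s \<Longrightarrow> s \<le> t \<Longrightarrow> X s \<omega> \<le> X t \<omega>"
    and X_right_const: "\<omega> \<in> space M \<Longrightarrow> 0 \<le> t \<Longrightarrow> \<exists>e>0. \<forall>u\<in>{t..<t + e}. X u \<omega> = X t \<omega>"

lemma (in counting_process) diff_measurable:
  assumes "0 \<le> s" "0 \<le> t"
  shows "(\<lambda>\<omega>. X t \<omega> - X s \<omega>) \<in> measurable M (count_space UNIV)"
proof -
  have "(\<lambda>\<omega>. (X t \<omega>, X s \<omega>)) \<in> measurable M (count_space UNIV \<Otimes>\<^sub>M count_space UNIV)"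
    using assms by (intro measurable_Pair measurable_X) auto
  then have "(\<lambda>\<omega>. (X t \<omega>, X s \<omega>)) \<in> measurable M (count_space UNIV)"
    by (simp add: pair_measure_countable)
  from measurable_compose[OF this measurable_count_space[of "\<lambda>(a, b). a - b"]]
  show ?thesis by simp
qed

lemma jump_time_nonneg: "0 \<le> jump_time X k \<omega>"
proof (induction k)
  case (Suc k)
  show ?case
    unfolding jump_time.simps by (rule Inf_greatest) (use Suc in \<open>auto intro: order_trans\<close>)
qed simp

lemma jump_time_le_Suc: "jump_time X k \<omega> \<le> jump_time X (Suc k) \<omega>"
  unfolding jump_time.simps by (rule Inf_greatest) auto

lemma jump_time_mono: "i \<le> j \<Longrightarrow> jump_time X i \<omega> \<le> jump_time X j \<omega>"
  by (rule lift_Suc_mono_le[of "\<lambda>k. jump_time X k \<omega>"]) (rule jump_time_le_Suc)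

text \<open>By monotonicity, equal values at \<open>T\<close> and \<open>T + s\<close> force the
  path to be constant in between. Right-continuity extends this beyond \<open>T + s\<close>, which
  makes the inequality strict.\<close>

lemma (in counting_process) jump_time_Suc_gt_iff:
  assumes \<omega>: "\<omega> \<in> space M" and T: "jump_time X k \<omega> = ereal T" and s: "0 \<le> s"
  shows "ereal (T + s) < jump_time X (Suc k) \<omega> \<longleftrightarrow> X (T + s) \<omega> = X T \<omega>"
proof
  assume *: "ereal (T + s) < jump_time X (Suc k) \<omega>"
  show "X (T + s) \<omega> = X T \<omega>"
  proof (rule ccontr)
    assume "X (T + s) \<omega> \<noteq> X T \<omega>"
    then have "jump_time X (Suc k) \<omega> \<le> ereal (T + s)"
      unfolding jump_time.simps T by (intro Inf_lower) (use s in auto)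
    with * show False by simp
  qed
next
  assume eq: "X (T + s) \<omega> = X T \<omega>"
  have T0: "0 \<le> T" using jump_time_nonneg[of X k \<omega>] T by simp
  obtain e where e: "e > 0" "\<And>u. u \<in> {T + s..<T + s + e} \<Longrightarrow> X u \<omega> = X (T + s) \<omega>"
    using X_right_const[OF \<omega> add_nonneg_nonneg[OF T0 s]] by blast
  have const: "X u \<omega> = X T \<omega>" if "T \<le> u" "u < T + s + e" for u
  proof (cases "u \<le> T + s")
    case True
    then show ?thesis
      using X_mono[OF \<omega>, of T u] X_mono[OF \<omega>, of u "T + s"] eq T0 that by simp
  qed (use e(2)[of u] eq that in auto)
  have "ereal (T + s + e) \<le> jump_time X (Suc k) \<omega>"
    unfolding jump_time.simps T
  proof (rule Inf_greatest, clarsimp)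
    fix t assume "T \<le> t" "X t \<omega> \<noteq> X T \<omega>"
    then show "T + s + e \<le> t" using const[of t] by linarith
  qed
  moreover have "ereal (T + s) < ereal (T + s + e)" using e by simp
  ultimately show "ereal (T + s) < jump_time X (Suc k) \<omega>" by (rule less_le_trans[rotated])
qed

text \<open>The countable union over rational times shows that jump times are stopping times.\<close>

lemma (in counting_process) jump_time_Suc_less_iff:
  assumes \<omega>: "\<omega> \<in> space M"
  shows "jump_time X (Suc k) \<omega> < ereal t \<longleftrightarrow>
    (\<exists>q\<in>\<rat>. \<exists>r\<in>\<rat>. 0 < q \<and> q < r \<and> r < t \<and> jump_time X k \<omega> < ereal q \<and> X r \<omega> \<noteq> X q \<omega>)"
    (is "_ \<longleftrightarrow> ?R")
proof
  assume "jump_time X (Suc k) \<omega> < ereal t"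
  then obtain u where u: "u < t" "jump_time X k \<omega> \<le> ereal u"
      "X u \<omega> \<noteq> X (real_of_ereal (jump_time X k \<omega>)) \<omega>"
    unfolding jump_time.simps Inf_less_iff by auto
  obtain T where T: "jump_time X k \<omega> = ereal T"
    using u(2) jump_time_nonneg[of X k \<omega>] by (cases "jump_time X k \<omega>") auto
  have T0: "0 \<le> T" using jump_time_nonneg[of X k \<omega>] T by simp
  obtain e where e: "e > 0" "\<And>v. v \<in> {T..<T + e} \<Longrightarrow> X v \<omega> = X T \<omega>"
    using X_right_const[OF \<omega> T0] by blast
  have u': "T \<le> u" "X u \<omega> \<noteq> X T \<omega>" using u T by auto
  then have uT: "T + e \<le> u" using e(2)[of u] by fastforce
  \<comment> \<open>\<open>q\<close> lies just after the \<open>k\<close>-th jump, before the path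
    changes again, and \<open>r\<close> lies between the change seen at \<open>u\<close> and
    \<open>t\<close>. Monotonicity carries the change over to these two rational times.\<close>
  obtain q where q: "q \<in> \<rat>" "T < q" "q < T + e"
    using Rats_dense_in_real[of T "T + e"] e(1) by auto
  obtain r where r: "r \<in> \<rat>" "u < r" "r < t"
    using Rats_dense_in_real[of u t] u(1) by auto
  have "X T \<omega> \<le> X u \<omega>" using X_mono[OF \<omega> T0 u'(1)] .
  moreover have "X u \<omega> \<le> X r \<omega>" using X_mono[OF \<omega>, of u r] T0 u' r by simp
  moreover have "X q \<omega> = X T \<omega>" using e(2)[of q] q by simp
  ultimately have "X r \<omega> \<noteq> X q \<omega>" using u'(2) by simp
  then show ?R using q r T0 T uT by (intro bexI[of _ q] bexI[of _ r]) auto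
next
  assume ?R
  then obtain q r where qr: "0 < q" "q < r" "r < t" "jump_time X k \<omega> < ereal q" "X r \<omega> \<noteq> X q \<omega>"
    by blast
  obtain T where T: "jump_time X k \<omega> = ereal T"
    using qr(4) jump_time_nonneg[of X k \<omega>] by (cases "jump_time X k \<omega>") auto
  have T0: "0 \<le> T" using jump_time_nonneg[of X k \<omega>] T by simp
  have "X T \<omega> \<le> X q \<omega>" "X q \<omega> \<le> X r \<omega>"
    using X_mono[OF \<omega>, of T q] X_mono[OF \<omega>, of q r] qr T T0 by auto
  with qr(5) have "X r \<omega> \<noteq> X T \<omega>" by simp
  then have "jump_time X (Suc k) \<omega> \<le> ereal r"
    unfolding jump_time.simps T by (intro Inf_lower) (use qr T in auto)
  also have "\<dots> < ereal t" using qr by simp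
  finally show "jump_time X (Suc k) \<omega> < ereal t" .
qed

text \<open>\<open>G\<close> stands for any \<sigma>-algebra that knows the path up to time
  \<open>t\<close>; the rational times describing the event lie below \<open>s\<close>, hence below
  \<open>t\<close>. Both the full \<sigma>-algebra and that of the past are used for
  \<open>G\<close>.\<close>

lemma (in counting_process) jump_time_less_sets:
  assumes G: "space G = space M" "\<And>u. 0 \<le> u \<Longrightarrow> u \<le> t \<Longrightarrow> X u \<in> measurable G (count_space UNIV)"
    and "s \<le> t"
  shows "{\<omega> \<in> space M. jump_time X k \<omega> < ereal s} \<in> sets G"
  using \<open>s \<le> t\<close>
proof (induction k arbitrary: s)
  case 0
  then show ?case by (auto simp: G(1)[symmetric])
next
  case (Suc k)
  let ?I = "{(q, r). q \<in> \<rat> \<and> r \<in> \<rat> \<and> 0 < q \<and> q < r \<and> r < s}"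
  have "countable ?I"
    by (rule countable_subset[of _ "\<rat> \<times> \<rat>"]) (auto intro: countable_rat)
  moreover have "{\<omega> \<in> space M. jump_time X (Suc k) \<omega> < ereal s} =
      (\<Union>p\<in>?I. {\<omega> \<in> space M. jump_time X k \<omega> < ereal (fst p)} \<inter>
        {\<omega> \<in> space G. X (snd p) \<omega> \<noteq> X (fst p) \<omega>})"
    using G(1) jump_time_Suc_less_iff by fastforce
  moreover have "{\<omega> \<in> space G. X r \<omega> \<noteq> X q \<omega>} \<in> sets G" if "(q, r) \<in> ?I" for q r
  proof -
    have "X r \<in> measurable G (count_space UNIV)" "X q \<in> measurable G (count_space UNIV)"
      using that Suc.prems by (auto intro!: G(2))
    then have [measurable]: "(\<lambda>\<omega>. real (X r \<omega>)) \<in> borel_measurable G" "(\<lambda>\<omega>. real (X q \<omega>)) \<in> borel_measurable G"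
      by auto
    have "{\<omega> \<in> space G. real (X r \<omega>) \<noteq> real (X q \<omega>)} \<in> sets G" by measurable
    then show ?thesis by simp
  qed
  ultimately show ?case
    using Suc by (auto intro!: sets.countable_UN')
qed

text \<open>Truncation at \<open>t\<close> turns the jump time into a random variable known at time
  \<open>t\<close>, so differences of jump times before \<open>t\<close> can be measured there
  too.\<close>

lemma (in counting_process) min_jump_time_measurable:
  assumes G: "space G = space M" "\<And>u. 0 \<le> u \<Longrightarrow> u \<le> t \<Longrightarrow> X u \<in> measurable G (count_space UNIV)"
  shows "(\<lambda>\<omega>. min (jump_time X k \<omega>) (ereal t)) \<in> borel_measurable G"
proof (rule borel_measurableI_less)
  fix y :: ereal
  consider "y > ereal t" | s where "y = ereal s" "s \<le> t" | "y = -\<infinity>"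
    by (cases y) force+
  then show "{\<omega> \<in> space G. min (jump_time X k \<omega>) (ereal t) < y} \<in> sets G"
  proof cases
    case 1
    then have "{\<omega> \<in> space G. min (jump_time X k \<omega>) (ereal t) < y} = space G"
      by (auto simp: min_less_iff_disj)
    then show ?thesis by simp
  next
    case 2
    then have "{\<omega> \<in> space G. min (jump_time X k \<omega>) (ereal t) < y} =
        {\<omega> \<in> space M. jump_time X k \<omega> < ereal s}"
      using G by (auto simp: min_less_iff_disj)
    then show ?thesis using jump_time_less_sets[OF G 2(2)] by simp
  qed simp
qed

lemma (in counting_process) jump_time_measurable [measurable]:
  "jump_time X k \<in> borel_measurable M"
proof (rule borel_measurable_LIMSEQ_order)
  show "(\<lambda>n. min (jump_time X k \<omega>) (ereal (real n))) \<longlonglongrightarrow> jump_time X k \<omega>" for \<omega>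
  proof -
    have "(\<lambda>n. min (jump_time X k \<omega>) (ereal (real n))) \<longlonglongrightarrow> min (jump_time X k \<omega>) \<infinity>"
      by (intro tendsto_min tendsto_const) (simp add: tendsto_PInfty_eq_at_top filterlim_real_sequentially)
    then show ?thesis by simp
  qed
  show "(\<lambda>\<omega>. min (jump_time X k \<omega>) (ereal (real n))) \<in> borel_measurable M" for n
    by (rule min_jump_time_measurable) (auto intro: measurable_X)
qed

lemma (in counting_process) sojourn_time_measurable [measurable]:
  "sojourn_time X k \<in> borel_measurable M"
proof -
  have [measurable]: "jump_time X j \<in> borel_measurable M" for j by (rule jump_time_measurable)
  show ?thesis unfolding sojourn_time_def[abs_def] by measurable
qed

subsection \<open>Strong Markov property at jump times\<close>

abbreviation path_algebra :: "real set \<Rightarrow> (real \<Rightarrow> nat) measure" where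
  "path_algebra I \<equiv> \<Pi>\<^sub>M _\<in>I. count_space UNIV"

text \<open>One equation holds both the independence of an increment from the whole path up to
  \<open>t\<close> and, with \<open>A\<close> the full path space, stationarity. The law of the
  increments stays open, so that the property can pass to compositions.\<close>

locale levy_counting_process = prob_space M + counting_process M X
  for M :: "'a measure" and X :: "real \<Rightarrow> 'a \<Rightarrow> nat" +
  assumes increments: "\<lbrakk>0 \<le> t; 0 \<le> s; A \<in> sets (path_algebra {0..t})\<rbrakk> \<Longrightarrow>
    prob {\<omega> \<in> space M. (\<lambda>u\<in>{0..t}. X u \<omega>) \<in> A \<and> X (t + s) \<omega> - X t \<omega> \<in> B} =
    prob {\<omega> \<in> space M. (\<lambda>u\<in>{0..t}. X u \<omega>) \<in> A} * prob {\<omega> \<in> space M. X s \<omega> \<in> B}"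
begin

text \<open>The natural filtration of \<open>X\<close>, pulled back from the path space over
  \<open>{0..t}\<close>.\<close>

definition past :: "real \<Rightarrow> 'a measure" where
  "past t = vimage_algebra (space M) (\<lambda>\<omega>. \<lambda>u\<in>{0..t}. X u \<omega>) (path_algebra {0..t})"

lemma space_past [simp]: "space (past t) = space M"
  by (simp add: past_def)

lemma path_measurable: "(\<lambda>\<omega>. \<lambda>u\<in>{0..t}. X u \<omega>) \<in> measurable M (path_algebra {0..t})"
  by (rule measurable_restrict) (auto intro: measurable_X)

lemma past_measurable: "0 \<le> u \<Longrightarrow> u \<le> t \<Longrightarrow> X u \<in> measurable (past t) (count_space UNIV)"
proof -
  assume u: "0 \<le> u" "u \<le> t"
  have "(\<lambda>\<omega>. \<lambda>u\<in>{0..t}. X u \<omega>) \<in> measurable (past t) (path_algebra {0..t})"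
    unfolding past_def by (rule measurable_vimage_algebra1) (auto simp: space_PiM)
  from measurable_compose[OF this measurable_component_singleton[of u]] u
  show ?thesis by (simp cong: measurable_cong)
qed

lemma past_sets: "A \<in> sets (past t) \<Longrightarrow> A \<in> sets M"
  using path_measurable[of t] unfolding past_def
  by (subst (asm) sets_vimage_algebra2) (auto simp: space_PiM intro: measurable_sets)

lemma past_indep:
  assumes "0 \<le> t" "0 \<le> s" "A \<in> sets (past t)"
  shows "prob {\<omega> \<in> A. X (t + s) \<omega> = X t \<omega>} = prob A * prob {\<omega> \<in> space M. X s \<omega> = 0}"
proof -
  obtain A' where A': "A' \<in> sets (path_algebra {0..t})"
      "A = {\<omega> \<in> space M. (\<lambda>u\<in>{0..t}. X u \<omega>) \<in> A'}"
    using assms(3) unfolding past_def by (subst (asm) sets_vimage_algebra2) (auto simp: space_PiM)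
  \<comment> \<open>A truncated difference equal to 0 gives only one inequality; monotonicity gives
    the other.\<close>
  have "{\<omega> \<in> A. X (t + s) \<omega> = X t \<omega>} =
      {\<omega> \<in> space M. (\<lambda>u\<in>{0..t}. X u \<omega>) \<in> A' \<and> X (t + s) \<omega> - X t \<omega> \<in> {0}}"
    using X_mono[of _ t "t + s"] assms(1,2) by (auto simp: A'(2) intro!: antisym)
  then show ?thesis using increments[OF assms(1,2) A'(1), of "{0}"] by (simp add: A'(2))
qed

text \<open>
  A strong Markov argument at the jump time \<open>T\<close>: replace \<open>T\<close> by the next point strictly above it
  of the grid of mesh \<open>1/(m+1)\<close>, use independence of the increments on each event that fixes this grid
  point, and let \<open>m\<close> tend to infinity; right-continuity makes the events converge.
\<close>

lemma sojourn_time_Suc: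
  fixes k :: nat and B :: "nat \<Rightarrow> ereal set"
  assumes r: "\<And>s. 0 \<le> s \<Longrightarrow> prob {\<omega> \<in> space M. X s \<omega> = 0} = exp (- r * s)"
    and s: "0 \<le> s"
    and B: "\<And>i. B i \<in> sets borel"
  defines "A \<equiv> {\<omega> \<in> space M. jump_time X k \<omega> < \<infinity> \<and> (\<forall>i\<in>{1..k}. sojourn_time X i \<omega> \<in> B i)}"
  shows "prob {\<omega> \<in> A. ereal s < sojourn_time X (Suc k) \<omega>} = prob A * exp (- r * s)"
proof -
  define T where "T \<omega> = real_of_ereal (jump_time X k \<omega>)" for \<omega>
  \<comment> \<open>\<open>idx m\<close> numbers the grid cell that contains \<open>T\<close>, and
    \<open>\<tau> m j\<close> is the right end of cell \<open>j\<close>. This end lies strictly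
    above \<open>T\<close>, so that the cell is known at time \<open>\<tau> m j\<close>.\<close>
  define idx where "idx m \<omega> = nat \<lfloor>T \<omega> * real (Suc m)\<rfloor>" for m \<omega>
  define \<tau> where "\<tau> m j = real (Suc j) / real (Suc m)" for m j
  define E where "E = {\<omega> \<in> A. ereal s < sojourn_time X (Suc k) \<omega>}"
  define C where "C m j = {\<omega> \<in> A. idx m \<omega> = j}" for m j
  define D where "D m = {\<omega> \<in> A. X (\<tau> m (idx m \<omega>) + s) \<omega> = X (\<tau> m (idx m \<omega>)) \<omega>}" for m
  have \<tau>0: "0 \<le> \<tau> m j" for m j by (simp add: \<tau>_def)
  have T: "jump_time X k \<omega> = ereal (T \<omega>)" "0 \<le> T \<omega>" if "\<omega> \<in> A" for \<omega>
    using that jump_time_nonneg[of X k \<omega>] unfolding A_def T_def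
    by (cases "jump_time X k \<omega>"; auto)+
  have idx_iff: "idx m \<omega> = j \<longleftrightarrow> real j / real (Suc m) \<le> T \<omega> \<and> T \<omega> < \<tau> m j" if "\<omega> \<in> A" for m j \<omega>
  proof -
    have "idx m \<omega> = j \<longleftrightarrow> \<lfloor>T \<omega> * real (Suc m)\<rfloor> = int j"
      using T(2)[OF that] unfolding idx_def by (auto simp: nat_eq_iff)
    also have "\<dots> \<longleftrightarrow> real j \<le> T \<omega> * real (Suc m) \<and> T \<omega> * real (Suc m) < real j + 1"
      by (simp add: floor_eq_iff)
    also have "\<dots> \<longleftrightarrow> real j / real (Suc m) \<le> T \<omega> \<and> T \<omega> < \<tau> m j"
      by (simp add: \<tau>_def pos_divide_le_eq pos_less_divide_eq add.commute del: of_nat_Suc)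
        (simp add: algebra_simps)
    finally show ?thesis .
  qed
  have A_sets [measurable]: "A \<in> sets M"
    using B unfolding A_def by measurable
  have C_past: "C m j \<in> sets (past (\<tau> m j))" for m j
  proof -
    let ?t = "\<tau> m j" and ?G = "past (\<tau> m j)"
    have jump: "{\<omega> \<in> space M. jump_time X k \<omega> < ereal u} \<in> sets ?G" if "u \<le> ?t" for u
      using past_measurable that by (intro jump_time_less_sets) auto
    have [measurable]: "(\<lambda>\<omega>. min (jump_time X i \<omega>) (ereal ?t)) \<in> borel_measurable ?G" for i
      using past_measurable by (intro min_jump_time_measurable) auto
    have soj: "{\<omega> \<in> space ?G. min (jump_time X i \<omega>) ?t - min (jump_time X (i - 1) \<omega>) ?t \<in> B i} \<in> sets ?G" for i
      using B by measurable
    \<comment> \<open>If the \<open>k\<close>-th jump time is below the grid point, then so are all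
      earlier ones, and truncating them there changes nothing. Thus the first \<open>k\<close>
      sojourn times can be read off from the past.\<close>
    have "C m j = ({\<omega> \<in> space M. jump_time X k \<omega> < ereal ?t} -
        {\<omega> \<in> space M. jump_time X k \<omega> < ereal (real j / real (Suc m))}) \<inter>
        {\<omega> \<in> space ?G. \<forall>i\<in>{1..k}. min (jump_time X i \<omega>) ?t - min (jump_time X (i - 1) \<omega>) ?t \<in> B i}"
      (is "_ = ?R")
    proof (rule set_eqI)
      fix \<omega>
      show "\<omega> \<in> C m j \<longleftrightarrow> \<omega> \<in> ?R"
      proof (cases "\<omega> \<in> space M \<and> jump_time X k \<omega> < ereal ?t")
        case True
        then have fin: "jump_time X i \<omega> < ereal ?t" if "i \<le> k" for i
          using jump_time_mono[OF that, of X \<omega>] by (auto intro: le_less_trans)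
        have "sojourn_time X i \<omega> = min (jump_time X i \<omega>) ?t - min (jump_time X (i - 1) \<omega>) ?t"
          if "i \<in> {1..k}" for i
        proof -
          have *: "jump_time X i \<omega> < ereal ?t" "jump_time X (i - 1) \<omega> < ereal ?t"
            using that by (auto intro!: fin)
          then have "jump_time X (i - 1) \<omega> < \<infinity>" by auto
          then show ?thesis
            unfolding sojourn_time_def min_absorb1[OF less_imp_le[OF *(1)]] min_absorb1[OF less_imp_le[OF *(2)]]
            by simp
        qed
        then have "\<omega> \<in> A \<longleftrightarrow> \<omega> \<in> {\<omega> \<in> space ?G. \<forall>i\<in>{1..k}. min (jump_time X i \<omega>) ?t - min (jump_time X (i - 1) \<omega>) ?t \<in> B i}"
          using True by (auto simp: A_def)
        then show ?thesis
          using True T(1)[of \<omega>] idx_iff[of \<omega> m j] by (auto simp: C_def not_less)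
      next
        case False
        then show ?thesis
          using T(1)[of \<omega>] idx_iff[of \<omega> m j] by (auto simp: C_def A_def)
      qed
    qed
    also have "\<dots> \<in> sets ?G"
      using soj by (intro sets.Int sets.Diff jump sets.sets_Collect_finite_All)
        (auto simp: \<tau>_def divide_right_mono)
    finally show ?thesis .
  qed
  have C_sets: "C m j \<in> sets M" for m j using C_past by (rule past_sets)
  have XC: "{\<omega> \<in> C m j. X (\<tau> m j + s) \<omega> = X (\<tau> m j) \<omega>} \<in> sets M" for m j
  proof -
    have [measurable]: "X (\<tau> m j + s) \<in> measurable M (count_space UNIV)"
        "X (\<tau> m j) \<in> measurable M (count_space UNIV)"
      using \<tau>0[of m j] s by (auto intro!: measurable_X)
    have [measurable]: "(\<lambda>\<omega>. real (X (\<tau> m j + s) \<omega>)) \<in> borel_measurable M"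
        "(\<lambda>\<omega>. real (X (\<tau> m j) \<omega>)) \<in> borel_measurable M"
      by auto
    have "C m j \<inter> {\<omega> \<in> space M. real (X (\<tau> m j + s) \<omega>) = real (X (\<tau> m j) \<omega>)} \<in> sets M"
      by (intro sets.Int C_sets) measurable
    also have "C m j \<inter> {\<omega> \<in> space M. real (X (\<tau> m j + s) \<omega>) = real (X (\<tau> m j) \<omega>)} =
        {\<omega> \<in> C m j. X (\<tau> m j + s) \<omega> = X (\<tau> m j) \<omega>}"
      using sets.sets_into_space[OF C_sets] by auto
    finally show ?thesis .
  qed
  have D_eq: "D m = (\<Union>j. {\<omega> \<in> C m j. X (\<tau> m j + s) \<omega> = X (\<tau> m j) \<omega>})" for m
    by (auto simp: D_def C_def)
  have D_sets: "D m \<in> sets M" for m unfolding D_eq using XC by blast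
  have E_sets: "E \<in> sets M"
  proof -
    have "E = A \<inter> {\<omega> \<in> space M. ereal s < sojourn_time X (Suc k) \<omega>}"
      using sets.sets_into_space[OF A_sets] by (auto simp: E_def)
    then show ?thesis by simp
  qed
  have prob_D: "prob (D m) = prob A * exp (- r * s)" for m
  proof -
    have "(\<lambda>j. prob (C m j)) sums prob (\<Union>j. C m j)"
      using C_sets by (intro finite_measure_UNION) (auto simp: disjoint_family_on_def C_def)
    also have "(\<Union>j. C m j) = A" by (auto simp: C_def)
    finally have "(\<lambda>j. prob (C m j) * exp (- r * s)) sums (prob A * exp (- r * s))"
      by (rule sums_mult2)
    moreover have "prob {\<omega> \<in> C m j. X (\<tau> m j + s) \<omega> = X (\<tau> m j) \<omega>} = prob (C m j) * exp (- r * s)" for j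
      using past_indep[OF \<tau>0 s C_past] r[OF s] by simp
    moreover have "(\<lambda>j. prob {\<omega> \<in> C m j. X (\<tau> m j + s) \<omega> = X (\<tau> m j) \<omega>}) sums prob (D m)"
      unfolding D_eq using XC
      by (intro finite_measure_UNION) (auto simp: disjoint_family_on_def C_def)
    ultimately show ?thesis by (simp add: sums_iff)
  qed
  \<comment> \<open>The convergence is pointwise and in fact eventual equality: once the mesh is
    smaller than the lengths of constancy after \<open>T\<close> and after \<open>T + s\<close>, the
    grid point sees the same values of the path as \<open>T\<close> does.\<close>
  have "(\<lambda>m. indicator (D m) \<omega> :: real) \<longlonglongrightarrow> indicator E \<omega>" for \<omega>
  proof (cases "\<omega> \<in> A")
    case True
    then have \<omega>: "\<omega> \<in> space M" by (simp add: A_def)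
    have *: "0 \<le> T \<omega> + s" using T(2)[OF True] s by simp
    obtain e1 where e1: "e1 > 0" "\<And>u. u \<in> {T \<omega>..<T \<omega> + e1} \<Longrightarrow> X u \<omega> = X (T \<omega>) \<omega>"
      using X_right_const[OF \<omega> T(2)[OF True]] by blast
    obtain e2 where e2: "e2 > 0" "\<And>u. u \<in> {T \<omega> + s..<T \<omega> + s + e2} \<Longrightarrow> X u \<omega> = X (T \<omega> + s) \<omega>"
      using X_right_const[OF \<omega> *] by blast
    have "ereal s < sojourn_time X (Suc k) \<omega> \<longleftrightarrow> ereal (T \<omega> + s) < jump_time X (Suc k) \<omega>"
      using T(1)[OF True] by (cases "jump_time X (Suc k) \<omega>") (auto simp: sojourn_time_def)
    also have "\<dots> \<longleftrightarrow> X (T \<omega> + s) \<omega> = X (T \<omega>) \<omega>"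
      by (rule jump_time_Suc_gt_iff[OF \<omega> T(1)[OF True] s])
    finally have E_iff: "\<omega> \<in> E \<longleftrightarrow> X (T \<omega> + s) \<omega> = X (T \<omega>) \<omega>"
      using True by (simp add: E_def)
    have "\<forall>\<^sub>F m in sequentially. inverse (real (Suc m)) < min e1 e2"
      using LIMSEQ_inverse_real_of_nat e1(1) e2(1) by (intro order_tendstoD(2)[of _ 0]) auto
    then have "\<forall>\<^sub>F m in sequentially. (indicator (D m) \<omega> :: real) = indicator E \<omega>"
    proof eventually_elim
      case (elim m)
      have "real (idx m \<omega>) / real (Suc m) \<le> T \<omega>" "T \<omega> < \<tau> m (idx m \<omega>)"
        using idx_iff[OF True, of m "idx m \<omega>"] by auto
      moreover have "\<tau> m (idx m \<omega>) = real (idx m \<omega>) / real (Suc m) + inverse (real (Suc m))"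
        by (simp add: \<tau>_def field_simps)
      ultimately have "T \<omega> \<le> \<tau> m (idx m \<omega>)" "\<tau> m (idx m \<omega>) < T \<omega> + e1" "\<tau> m (idx m \<omega>) < T \<omega> + e2"
        using elim by auto
      then have "X (\<tau> m (idx m \<omega>)) \<omega> = X (T \<omega>) \<omega>" "X (\<tau> m (idx m \<omega>) + s) \<omega> = X (T \<omega> + s) \<omega>"
        by (auto intro!: e1(2) e2(2))
      then show ?case using E_iff True by (simp add: D_def indicator_def)
    qed
    then show ?thesis by (rule tendsto_eventually)
  next
    case False
    then show ?thesis by (simp add: D_def E_def)
  qed
  then have "(\<lambda>m. \<integral>\<omega>. indicator (D m) \<omega> \<partial>M) \<longlonglongrightarrow> (\<integral>\<omega>. (indicator E \<omega> :: real) \<partial>M)"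
    using D_sets E_sets
    by (intro integral_dominated_convergence[where w="\<lambda>_. 1"]) (auto simp: indicator_def)
  then have "(\<lambda>m. prob (D m)) \<longlonglongrightarrow> prob E"
    using D_sets E_sets sets.sets_into_space by (simp add: Int_absorb2)
  \<comment> \<open>The probability of \<open>D m\<close> does not depend on \<open>m\<close>, so it
    equals the limit.\<close>
  then have "(\<lambda>m. prob A * exp (- r * s)) \<longlonglongrightarrow> prob E"
    unfolding prob_D .
  then have "prob A * exp (- r * s) = prob E" by (simp add: LIMSEQ_const_iff)
  then show ?thesis by (simp add: E_def)
qed

end

subsection \<open>The law of the sojourn times\<close>

lemma prob_space_exponential_law: "0 < r \<Longrightarrow> prob_space (exponential_law r)"
  unfolding exponential_law_def
  by (intro prob_space.prob_space_distr prob_space_exponential_density) auto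

lemma sets_exponential_law [simp, measurable_cong]: "sets (exponential_law r) = sets borel"
  by (simp add: exponential_law_def)

lemma space_exponential_law [simp]: "space (exponential_law r) = UNIV"
  by (simp add: exponential_law_def)

text \<open>Tails over all extended reals are computed because the half-lines \<open>{x<..}\<close>
  generate the Borel sets of \<open>ereal\<close> and are used below to identify laws.\<close>

lemma emeasure_exponential_law_gt:
  assumes "0 < r"
  shows "emeasure (exponential_law r) {x<..} =
    (if x < 0 then 1 else if x = \<infinity> then 0 else ennreal (exp (- r * real_of_ereal x)))"
proof -
  let ?D = "density lborel (exponential_density r)"
  interpret D: prob_space ?D by (rule prob_space_exponential_density) fact
  have gt: "emeasure ?D {a<..} = ennreal (if a < 0 then 1 else exp (- r * a))" for a
  proof -
    have "emeasure ?D {..a} = ennreal (erlang_CDF 0 r a)"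
      by (rule emeasure_erlang_density) fact
    then have "D.prob {..a} = erlang_CDF 0 r a"
      using erlang_CDF_nonneg[OF assms] by (simp add: measure_def)
    moreover have "D.prob {a<..} = 1 - D.prob {..a}"
      using D.prob_compl[of "{..a}"] by (simp add: Compl_atMost Compl_eq_Diff_UNIV[symmetric])
    ultimately show ?thesis by (simp add: D.emeasure_eq_measure erlang_CDF_0)
  qed
  have *: "emeasure (exponential_law r) {x<..} = emeasure ?D {a. x < ereal a}"
    unfolding exponential_law_def by (subst emeasure_distr) (auto simp: vimage_def)
  show ?thesis
  proof (cases x)
    case (real a)
    have "{b. ereal a < ereal b} = {a<..}" by auto
    then show ?thesis using gt[of a] * real by simp
  qed (use * D.emeasure_space_1 in auto)
qed

context levy_counting_process
begin

text \<open>If the next jump never comes, the sojourn time exceeds every \<open>n\<close>, an event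
  of probability at most \<open>exp (- r * n)\<close>. This removes the finiteness condition from
  the event in \<open>sojourn_time_Suc\<close>.\<close>

lemma AE_jump_time_finite:
  assumes r: "\<And>s. 0 \<le> s \<Longrightarrow> prob {\<omega> \<in> space M. X s \<omega> = 0} = exp (- r * s)" and "0 < r"
  shows "AE \<omega> in M. jump_time X k \<omega> < \<infinity>"
proof (induction k)
  case (Suc k)
  let ?A = "{\<omega> \<in> space M. jump_time X k \<omega> < \<infinity>}"
  let ?I = "{\<omega> \<in> ?A. jump_time X (Suc k) \<omega> = \<infinity>}"
  have "prob ?A = 1" using Suc by (subst prob_Collect_eq_1) auto
  then have le: "prob ?I \<le> exp (- r * real n)" for n
  proof -
    have "prob ?I \<le> prob {\<omega> \<in> ?A. ereal (real n) < sojourn_time X (Suc k) \<omega>}"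
      by (rule finite_measure_mono) (auto simp: sojourn_time_def)
    also have "\<dots> = exp (- r * real n)"
      using sojourn_time_Suc[OF r, of "real n" "\<lambda>_. UNIV" k] \<open>prob ?A = 1\<close> by simp
    finally show ?thesis .
  qed
  have "(\<lambda>n. exp (- r) ^ n) \<longlonglongrightarrow> 0"
    using \<open>0 < r\<close> by (intro LIMSEQ_power_zero) simp
  then have "(\<lambda>n. exp (- r * real n)) \<longlonglongrightarrow> 0"
    by (simp only: exp_of_nat2_mult)
  then have "prob ?I \<le> 0" by (rule LIMSEQ_le_const) (use le in auto)
  moreover have "?I \<in> events" by measurable
  ultimately have "AE \<omega> in M. \<omega> \<notin> ?I"
    by (intro AE_I[of _ _ ?I]) (auto simp: emeasure_eq_measure measure_le_0_iff)
  with Suc AE_space show ?case by eventually_elim auto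
qed simp

text \<open>Passes from tails to arbitrary Borel sets: two finite measures that agree on an
  intersection-stable generator are equal.\<close>

lemma prob_sojourn_time_Suc:
  fixes k :: nat and B :: "nat \<Rightarrow> ereal set"
  assumes r: "\<And>s. 0 \<le> s \<Longrightarrow> prob {\<omega> \<in> space M. X s \<omega> = 0} = exp (- r * s)" and "0 < r"
    and B: "\<And>i. B i \<in> sets borel" and C: "C \<in> sets borel"
  defines "A \<equiv> {\<omega> \<in> space M. \<forall>i\<in>{1..k}. sojourn_time X i \<omega> \<in> B i}"
  shows "prob {\<omega> \<in> A. sojourn_time X (Suc k) \<omega> \<in> C} = prob A * measure (exponential_law r) C"
proof -
  let ?S = "sojourn_time X (Suc k)"
  \<comment> \<open>The law of the next sojourn time restricted to the event \<open>A\<close>, of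
    total mass \<open>prob A\<close>; it is compared with the exponential law scaled by the same
    mass.\<close>
  let ?\<mu> = "distr (density M (indicator A)) borel ?S"
  let ?\<nu> = "scale_measure (ennreal (prob A)) (exponential_law r)"
  \<comment> \<open>With \<open>UNIV\<close> in the generator, the constant sequence
    \<open>UNIV\<close> is an exhaustion by generator sets of finite measure.\<close>
  let ?E = "insert UNIV (range greaterThan) :: ereal set set"
  interpret L: prob_space "exponential_law r" by (rule prob_space_exponential_law) fact
  have A [measurable]: "A \<in> sets M" using B unfolding A_def by measurable
  have S: "?S -` D \<inter> A \<in> sets M" if "D \<in> sets borel" for D
    using measurable_sets[OF sojourn_time_measurable that, of "Suc k"] A
      sets.sets_into_space[OF A] sets.Int[of "?S -` D \<inter> space M" M A]
    by (simp add: Int_assoc Int_absorb1)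
  have \<mu>: "emeasure ?\<mu> D = ennreal (prob (?S -` D \<inter> A))" if D: "D \<in> sets borel" for D
  proof -
    have "emeasure ?\<mu> D = (\<integral>\<^sup>+\<omega>. indicator A \<omega> * indicator (?S -` D \<inter> space M) \<omega> \<partial>M)"
      using D by (simp add: emeasure_distr emeasure_density)
    also have "\<dots> = (\<integral>\<^sup>+\<omega>. indicator (?S -` D \<inter> A) \<omega> \<partial>M)"
      using sets.sets_into_space[OF A] by (intro nn_integral_cong) (auto simp: indicator_def)
    also have "\<dots> = ennreal (prob (?S -` D \<inter> A))"
      using S[OF D] by (simp add: emeasure_eq_measure)
    finally show ?thesis .
  qed
  have "?\<mu> = ?\<nu>"
  proof (rule measure_eqI_generator_eq)
    have "{a<..} \<inter> {b<..} = {max a b<..}" for a b :: ereal by auto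
    then show "Int_stable ?E" by (auto simp: Int_stable_def)
    have borel: "sets borel = sigma_sets UNIV ?E"
    proof
      show "sets borel \<subseteq> sigma_sets UNIV ?E"
        unfolding borel_Ioi by (simp, rule sigma_sets_mono'') auto
      show "sigma_sets UNIV ?E \<subseteq> sets borel"
        by (rule sets.sigma_sets_subset[of _ borel, simplified]) auto
    qed
    show "sets ?\<mu> = sigma_sets UNIV ?E" "sets ?\<nu> = sigma_sets UNIV ?E"
      using borel by simp_all
    show "range (\<lambda>_. UNIV :: ereal set) \<subseteq> ?E" "(\<Union>i::nat. UNIV :: ereal set) = UNIV"
      by auto
    show "emeasure ?\<mu> UNIV \<noteq> \<infinity>" by (simp add: \<mu>)
    fix D assume "D \<in> ?E"
    then consider "D = UNIV" | x where "D = {x<..}" by auto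
    then show "emeasure ?\<mu> D = emeasure ?\<nu> D"
    proof cases
      case 1
      then show ?thesis using L.emeasure_space_1 by (simp add: \<mu>)
    next
      case 2
      consider "x < 0" | "x = \<infinity>" | s where "x = ereal s" "0 \<le> s"
        by (cases x) force+
      then show ?thesis
      proof cases
        case 1
        have "0 \<le> ?S \<omega>" for \<omega>
          using jump_time_le_Suc[of X k \<omega>] by (auto simp: sojourn_time_def ereal_diff_positive)
        with 1 have "?S -` D \<inter> A = A" using 2 by (auto intro: less_le_trans)
        then show ?thesis using 1 2 by (simp add: \<mu> emeasure_exponential_law_gt[OF \<open>0 < r\<close>])
      next
        case 2
        then show ?thesis using \<open>D = {x<..}\<close>
          by (simp add: \<mu> emeasure_exponential_law_gt[OF \<open>0 < r\<close>] vimage_def)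
      next
        case (3 s)
        let ?A = "{\<omega> \<in> space M. jump_time X k \<omega> < \<infinity> \<and> (\<forall>i\<in>{1..k}. sojourn_time X i \<omega> \<in> B i)}"
        have meas: "?A \<in> events" "{\<omega> \<in> ?A. ereal s < ?S \<omega>} \<in> events"
          using B by measurable
        have fin: "AE \<omega> in M. jump_time X k \<omega> < \<infinity>"
          by (rule AE_jump_time_finite) (use r \<open>0 < r\<close> in auto)
        \<comment> \<open>\<open>A\<close> and \<open>?A\<close> differ only by the null event of an
          infinite jump time, so the tail formula on \<open>?A\<close> carries over to
          \<open>A\<close>.\<close>
        have "AE \<omega> in M. \<omega> \<in> ?S -` D \<inter> A \<longleftrightarrow> \<omega> \<in> {\<omega> \<in> ?A. ereal s < ?S \<omega>}"
          using fin by eventually_elim (auto simp: \<open>D = {x<..}\<close> 3 A_def)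
        then have "prob (?S -` D \<inter> A) = prob {\<omega> \<in> ?A. ereal s < ?S \<omega>}"
          by (rule finite_measure_eq_AE) (use S meas \<open>D = {x<..}\<close> in auto)
        also have "\<dots> = prob ?A * exp (- r * s)"
          using sojourn_time_Suc[OF r \<open>0 \<le> s\<close> B] by simp
        also have "prob ?A = prob A"
        proof (rule finite_measure_eq_AE)
          show "AE \<omega> in M. \<omega> \<in> ?A \<longleftrightarrow> \<omega> \<in> A"
            using fin by eventually_elim (auto simp: A_def)
        qed (use meas A in auto)
        finally show ?thesis
          using \<open>D = {x<..}\<close> 3 by (simp add: \<mu> emeasure_exponential_law_gt[OF \<open>0 < r\<close>] ennreal_mult)
      qed
    qed
  qed auto
  then have "ennreal (prob (?S -` C \<inter> A)) = ennreal (prob A * measure (exponential_law r) C)"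
    using C \<mu>[OF C] by (simp add: L.emeasure_eq_measure ennreal_mult)
  then have "prob (?S -` C \<inter> A) = prob A * measure (exponential_law r) C"
    by (simp add: measure_nonneg)
  moreover have "?S -` C \<inter> A = {\<omega> \<in> A. ?S \<omega> \<in> C}" by auto
  ultimately show ?thesis by simp
qed

lemma prob_sojourn_times:
  assumes r: "\<And>s. 0 \<le> s \<Longrightarrow> prob {\<omega> \<in> space M. X s \<omega> = 0} = exp (- r * s)" and "0 < r"
    and B: "\<And>i. B i \<in> sets borel"
  shows "prob {\<omega> \<in> space M. \<forall>i\<in>{1..k}. sojourn_time X i \<omega> \<in> B i} =
    (\<Prod>i\<in>{1..k}. measure (exponential_law r) (B i))"
proof (induction k)
  case 0
  then show ?case by (simp add: prob_space)
next
  case (Suc k)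
  have "{\<omega> \<in> space M. \<forall>i\<in>{1..Suc k}. sojourn_time X i \<omega> \<in> B i} =
      {\<omega> \<in> {\<omega> \<in> space M. \<forall>i\<in>{1..k}. sojourn_time X i \<omega> \<in> B i}. sojourn_time X (Suc k) \<omega> \<in> B (Suc k)}"
    by (auto simp: atLeastAtMostSuc_conv)
  then show ?case
    using prob_sojourn_time_Suc[OF assms B[of "Suc k"], of k] Suc by simp
qed

lemma distr_sojourn_time:
  assumes r: "\<And>s. 0 \<le> s \<Longrightarrow> prob {\<omega> \<in> space M. X s \<omega> = 0} = exp (- r * s)" and "0 < r"
    and "1 \<le> k"
  shows "distr M borel (sojourn_time X k) = exponential_law r"
proof (rule measure_eqI)
  interpret L: prob_space "exponential_law r" by (rule prob_space_exponential_law) fact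
  fix C assume "C \<in> sets (distr M borel (sojourn_time X k))"
  then have C: "C \<in> sets borel" by simp
  obtain j where j: "k = Suc j" using \<open>1 \<le> k\<close> by (cases k) auto
  \<comment> \<open>With no condition on the earlier sojourn times, the conditioning event is the
    whole space.\<close>
  have "prob {\<omega> \<in> space M. sojourn_time X k \<omega> \<in> C} = measure (exponential_law r) C"
    using prob_sojourn_time_Suc[OF r \<open>0 < r\<close> _ C, of "\<lambda>_. UNIV" j] by (simp add: j prob_space)
  then show "emeasure (distr M borel (sojourn_time X k)) C = emeasure (exponential_law r) C"
    using C by (simp add: emeasure_distr emeasure_eq_measure L.emeasure_eq_measure vimage_def Int_def conj_commute)
qed simp

lemma indep_sojourn_times:
  assumes r: "\<And>s. 0 \<le> s \<Longrightarrow> prob {\<omega> \<in> space M. X s \<omega> = 0} = exp (- r * s)" and "0 < r"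
  shows "indep_vars (\<lambda>_. borel) (\<lambda>k. sojourn_time X k) {1..}"
  unfolding indep_vars_def2
proof (intro conjI ballI indep_setsI)
  interpret L: prob_space "exponential_law r" by (rule prob_space_exponential_law) fact
  fix A and J :: "nat set"
  assume J: "J \<noteq> {}" "J \<subseteq> {1..}" "finite J"
    and "\<forall>j\<in>J. A j \<in> {sojourn_time X j -` B \<inter> space M |B. B \<in> sets borel}"
  then obtain B where B: "\<And>j. j \<in> J \<Longrightarrow> B j \<in> sets borel"
      "\<And>j. j \<in> J \<Longrightarrow> A j = sojourn_time X j -` B j \<inter> space M"
    by (simp add: Ball_def) metis
  \<comment> \<open>Indices missing from \<open>J\<close> are filled in with \<open>UNIV\<close>, so
    that the product formula for the initial segment \<open>{1..Max J}\<close> applies; the added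
    factors are 1.\<close>
  define B' where "B' j = (if j \<in> J then B j else UNIV)" for j
  have B': "B' j \<in> sets borel" for j using B(1) by (auto simp: B'_def)
  have sub: "J \<subseteq> {1..Max J}" using J by auto
  have A: "prob (A j) = measure (exponential_law r) (B j)" if "j \<in> J" for j
  proof -
    have "prob (A j) = measure (distr M borel (sojourn_time X j)) (B j)"
      using that B by (simp add: measure_distr)
    then show ?thesis using distr_sojourn_time[OF assms, of j] that J by auto
  qed
  have "(\<Inter>j\<in>J. A j) = {\<omega> \<in> space M. \<forall>i\<in>{1..Max J}. sojourn_time X i \<omega> \<in> B' i}"
    using J(1) sub by (auto simp: B(2) B'_def)
  then have "prob (\<Inter>j\<in>J. A j) = (\<Prod>i\<in>{1..Max J}. measure (exponential_law r) (B' i))"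
    using prob_sojourn_times[OF assms B'] by simp
  also have "\<dots> = (\<Prod>i\<in>J. measure (exponential_law r) (B' i))"
    using sub L.prob_space by (intro prod.mono_neutral_right) (auto simp: B'_def)
  also have "\<dots> = (\<Prod>j\<in>J. prob (A j))"
    using A by (intro prod.cong) (auto simp: B'_def)
  finally show "prob (\<Inter>j\<in>J. A j) = (\<Prod>j\<in>J. prob (A j))" .
qed auto

end

subsection \<open>Poisson processes\<close>

lemma poisson_counting_process:
  assumes "poisson_process M lam X"
  shows "counting_process M X"
proof
  fix t :: real and \<omega> assume \<omega>: "\<omega> \<in> space M" and t: "0 \<le> t"
  have "((\<lambda>s. X s \<omega>) \<longlongrightarrow> X t \<omega>) (at_right t)"
    using assms \<omega> t by (auto simp: poisson_process_def continuous_within)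
  \<comment> \<open>The singleton of the current value is an open set in the discrete
    topology.\<close>
  then have "\<forall>\<^sub>F u in at_right t. X u \<omega> \<in> {X t \<omega>}"
    by (rule topological_tendstoD) (simp_all add: Topological_Spaces.open_discrete)
  then obtain b where b: "b > t" "\<And>u. t < u \<Longrightarrow> u < b \<Longrightarrow> X u \<omega> = X t \<omega>"
    by (subst (asm) eventually_at_right[of t "t + 1"]) auto
  show "\<exists>e>0. \<forall>u\<in>{t..<t + e}. X u \<omega> = X t \<omega>"
  proof (intro exI[of _ "b - t"] conjI ballI)
    show "X u \<omega> = X t \<omega>" if "u \<in> {t..<t + (b - t)}" for u
      using b(2)[of u] that by (cases "u = t") auto
  qed (use b in auto)
qed (use assms in \<open>auto simp: poisson_process_def mono_on_def\<close>)

lemma (in prob_space) poisson_increment_prob: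
  assumes "poisson_process M lam X" "0 \<le> t" "0 < s"
  shows "prob {\<omega> \<in> space M. X (t + s) \<omega> - X t \<omega> \<in> B} = measure (measure_pmf (poisson_pmf (lam * s))) B"
proof -
  interpret counting_process M X by (rule poisson_counting_process) fact
  have meas: "(\<lambda>\<omega>. X (t + s) \<omega> - X t \<omega>) \<in> measurable M (count_space UNIV)"
    using assms by (intro diff_measurable) auto
  have "prob {\<omega> \<in> space M. X (t + s) \<omega> - X t \<omega> \<in> B} =
      measure (distr M (count_space UNIV) (\<lambda>\<omega>. X (t + s) \<omega> - X t \<omega>)) B"
    using meas by (simp add: measure_distr vimage_def Int_def conj_commute)
  also have "\<dots> = measure (measure_pmf (poisson_pmf (lam * s))) B"
    using assms unfolding poisson_process_def by simp
  finally show ?thesis by simp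
qed

text \<open>The values of \<open>X\<close> on \<open>J\<close> are partial sums of increments over a
  finite grid of \<open>{0..t}\<close>, and \<open>X (t + s) - X t\<close> is the next increment.
  Independence of the increments therefore separates the two events.\<close>

lemma (in prob_space) poisson_increments_cylinder:
  assumes pp: "poisson_process M lam X" and t: "0 \<le> t" and s: "0 < s"
    and J: "finite J" "J \<subseteq> {0..t}"
  shows "prob {\<omega> \<in> space M. (\<forall>u\<in>J. X u \<omega> \<in> A u) \<and> X (t + s) \<omega> - X t \<omega> \<in> B} =
    prob {\<omega> \<in> space M. \<forall>u\<in>J. X u \<omega> \<in> A u} * prob {\<omega> \<in> space M. X (t + s) \<omega> - X t \<omega> \<in> B}"
proof -
  interpret counting_process M X by (rule poisson_counting_process) fact
  \<comment> \<open>The point 0 makes the partial sums start at \<open>X 0 = 0\<close>, and the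
    point \<open>t\<close> makes the next increment start at \<open>t\<close>.\<close>
  define l where "l = sorted_list_of_set (insert 0 (insert t J))"
  have set_l: "set l = insert 0 (insert t J)" and sorted: "sorted_wrt (<) l"
    using J(1) unfolding l_def by (simp_all only: set_sorted_list_of_set strict_sorted_list_of_set finite_insert)
  have len: "length l > 0" using set_l by (cases l) auto
  define n where "n = length l - 1"
  have l_mono: "l ! i \<le> l ! j" if "i \<le> j" "j \<le> n" for i j
  proof -
    have "j < length l" using that(2) len unfolding n_def by linarith
    then show ?thesis using sorted_wrt_nth_less[OF sorted, of i j] that(1) by (cases "i = j") auto
  qed
  have l_bounds: "0 \<le> l ! i" "l ! i \<le> t" if "i \<le> n" for i
  proof -
    have "i < length l" using that len unfolding n_def by linarith
    then have "l ! i \<in> insert 0 (insert t J)" using set_l nth_mem by blast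
    then show "0 \<le> l ! i" "l ! i \<le> t" using J(2) t by auto
  qed
  obtain i0 where i0: "i0 \<le> n" "l ! i0 = 0"
    using set_l len by (metis One_nat_def Suc_pred in_set_conv_nth insertI1 less_Suc_eq_le n_def)
  obtain it where it: "it \<le> n" "l ! it = t"
    using set_l len by (metis One_nat_def Suc_pred in_set_conv_nth insertI1 insertI2 less_Suc_eq_le n_def)
  have l0: "l ! 0 = 0" and ln: "l ! n = t"
    using l_mono[of 0 i0] l_mono[of it n] l_bounds[of 0] l_bounds[of n] i0 it by auto
  \<comment> \<open>The definition of a Poisson process asks for an infinite strictly increasing
    sequence of times, so the grid is continued after \<open>t\<close> with step \<open>s\<close>;
    in particular \<open>\<tau> (Suc n) = t + s\<close>.\<close>
  define \<tau> where "\<tau> i = (if i \<le> n then l ! i else t + s * real (i - n))" for i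
  have \<tau>_mono: "strict_mono \<tau>"
    unfolding strict_mono_Suc_iff
  proof
    fix i
    consider "Suc i \<le> n" | "i = n" | "n < i" by linarith
    then show "\<tau> i < \<tau> (Suc i)"
    proof cases
      case 1
      then show ?thesis
        using sorted_wrt_nth_less[OF sorted, of i "Suc i"] by (simp add: \<tau>_def n_def)
    qed (use s ln in \<open>auto simp: \<tau>_def Suc_diff_le algebra_simps\<close>)
  qed
  define D where "D i \<omega> = X (\<tau> (Suc i)) \<omega> - X (\<tau> i) \<omega>" for i \<omega>
  have \<tau>0: "\<tau> 0 = 0" using l0 by (simp add: \<tau>_def)
  have "indep_vars (\<lambda>_. count_space UNIV) D {..<Suc n}"
    using pp \<tau>0 \<tau>_mono unfolding poisson_process_def D_def[abs_def] by auto
  then have indep: "indep_var (\<Pi>\<^sub>M _\<in>{..<n}. count_space UNIV) (\<lambda>\<omega>. \<lambda>i\<in>{..<n}. D i \<omega>)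
      (\<Pi>\<^sub>M _\<in>{n}. count_space UNIV) (\<lambda>\<omega>. \<lambda>i\<in>{n}. D i \<omega>)"
    by (rule indep_var_restrict) auto
  have X_eq: "X (l ! i) \<omega> = (\<Sum>j<i. D j \<omega>)" if "i \<le> n" "\<omega> \<in> space M" for i \<omega>
    using that(1)
  proof (induction i)
    case (Suc i)
    \<comment> \<open>Monotonicity lets the truncated differences telescope.\<close>
    have "X (l ! i) \<omega> \<le> X (l ! Suc i) \<omega>"
      using l_bounds[of i] l_mono[of i "Suc i"] Suc by (intro X_mono that) auto
    then show ?case using Suc by (simp add: D_def \<tau>_def)
  qed (use X_zero that l0 in auto)
  have Dn: "D n \<omega> = X (t + s) \<omega> - X t \<omega>" for \<omega>
    using ln by (simp add: D_def \<tau>_def)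
  define S where "S = {d \<in> PiE {..<n} (\<lambda>_. UNIV :: nat set). \<forall>i\<le>n. l ! i \<in> J \<longrightarrow> (\<Sum>j<i. d j) \<in> A (l ! i)}"
  have S_iff: "(\<lambda>i\<in>{..<n}. D i \<omega>) \<in> S \<longleftrightarrow> (\<forall>u\<in>J. X u \<omega> \<in> A u)" if "\<omega> \<in> space M" for \<omega>
  proof -
    have "(\<lambda>i\<in>{..<n}. D i \<omega>) \<in> S \<longleftrightarrow> (\<forall>i\<le>n. l ! i \<in> J \<longrightarrow> X (l ! i) \<omega> \<in> A (l ! i))"
      by (simp add: S_def X_eq that)
    also have "\<dots> \<longleftrightarrow> (\<forall>u\<in>J. X u \<omega> \<in> A u)"
    proof safe
      fix u assume *: "\<forall>i\<le>n. l ! i \<in> J \<longrightarrow> X (l ! i) \<omega> \<in> A (l ! i)" "u \<in> J"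
      then have "u \<in> set l" using set_l by auto
      then obtain i where "i < length l" "l ! i = u" by (auto simp: in_set_conv_nth)
      then show "X u \<omega> \<in> A u" using * by (auto simp: n_def)
    qed auto
    finally show ?thesis .
  qed
  have "prob ((\<lambda>\<omega>. (\<lambda>i\<in>{..<n}. D i \<omega>, \<lambda>i\<in>{n}. D i \<omega>)) -` (S \<times> PiE {n} (\<lambda>_. B)) \<inter> space M) =
      prob ((\<lambda>\<omega>. \<lambda>i\<in>{..<n}. D i \<omega>) -` S \<inter> space M) * prob ((\<lambda>\<omega>. \<lambda>i\<in>{n}. D i \<omega>) -` PiE {n} (\<lambda>_. B) \<inter> space M)"
    by (intro indep_varD[OF indep]) (auto simp: count_space_PiM_finite S_def)
  moreover have "(\<lambda>\<omega>. (\<lambda>i\<in>{..<n}. D i \<omega>, \<lambda>i\<in>{n}. D i \<omega>)) -` (S \<times> PiE {n} (\<lambda>_. B)) \<inter> space M =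
      {\<omega> \<in> space M. (\<forall>u\<in>J. X u \<omega> \<in> A u) \<and> X (t + s) \<omega> - X t \<omega> \<in> B}"
    using S_iff Dn by (auto simp: PiE_iff)
  moreover have "(\<lambda>\<omega>. \<lambda>i\<in>{..<n}. D i \<omega>) -` S \<inter> space M = {\<omega> \<in> space M. \<forall>u\<in>J. X u \<omega> \<in> A u}"
    using S_iff by auto
  moreover have "(\<lambda>\<omega>. \<lambda>i\<in>{n}. D i \<omega>) -` PiE {n} (\<lambda>_. B) \<inter> space M =
      {\<omega> \<in> space M. X (t + s) \<omega> - X t \<omega> \<in> B}"
    using Dn by (auto simp: PiE_iff)
  ultimately show ?thesis by simp
qed

text \<open>Cylinder sets determine a finite measure on the path space, so the independence known
  for finitely many times extends to the whole past.\<close>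

lemma (in prob_space) poisson_levy_counting_process:
  assumes pp: "poisson_process M lam X"
  shows "levy_counting_process M X"
proof -
  interpret counting_process M X by (rule poisson_counting_process) fact
  show ?thesis
  proof
    fix t s :: real and A B
    assume t: "0 \<le> t" and s: "0 \<le> s" and A: "A \<in> sets (path_algebra {0..t})"
    let ?W = "\<lambda>\<omega>. \<lambda>u\<in>{0..t}. X u \<omega>" and ?D = "{\<omega> \<in> space M. X (t + s) \<omega> - X t \<omega> \<in> B}"
    show "prob {\<omega> \<in> space M. ?W \<omega> \<in> A \<and> X (t + s) \<omega> - X t \<omega> \<in> B} =
      prob {\<omega> \<in> space M. ?W \<omega> \<in> A} * prob {\<omega> \<in> space M. X s \<omega> \<in> B}"
    \<comment> \<open>The Poisson law of increments is prescribed for positive lengths only; for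
      length 0 both sides reduce to whether \<open>B\<close> contains 0.\<close>
    proof (cases "s = 0")
      case True
      have "{\<omega> \<in> space M. X 0 \<omega> \<in> B} = (if 0 \<in> B then space M else {})"
        using X_zero by auto
      then show ?thesis using True by (simp add: prob_space)
    next
      case False
      with s have s: "0 < s" by simp
      have W: "?W \<in> measurable M (path_algebra {0..t})"
        by (rule measurable_restrict) (auto intro: measurable_X)
      have "(\<lambda>\<omega>. X (t + s) \<omega> - X t \<omega>) \<in> measurable M (count_space UNIV)"
        using t s by (intro diff_measurable) auto
      from measurable_sets[OF this, of B] have D: "?D \<in> sets M"
        by (simp add: vimage_def Int_def conj_commute)
      let ?P = "distr (density M (indicator ?D)) (path_algebra {0..t}) ?W"
      let ?Q = "scale_measure (ennreal (prob ?D)) (distr M (path_algebra {0..t}) ?W)"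
      have P: "emeasure ?P C = ennreal (prob {\<omega> \<in> space M. ?W \<omega> \<in> C \<and> X (t + s) \<omega> - X t \<omega> \<in> B})"
        if C: "C \<in> sets (path_algebra {0..t})" for C
      proof -
        have WB: "?W -` C \<inter> space M \<in> sets M" using W C by (rule measurable_sets)
        have "emeasure ?P C = (\<integral>\<^sup>+\<omega>. indicator ?D \<omega> * indicator (?W -` C \<inter> space M) \<omega> \<partial>M)"
          using W C D WB by (simp add: emeasure_distr emeasure_density)
        also have "\<dots> = (\<integral>\<^sup>+\<omega>. indicator (?D \<inter> (?W -` C \<inter> space M)) \<omega> \<partial>M)"
          by (simp add: indicator_inter_arith)
        also have "\<dots> = ennreal (prob (?D \<inter> (?W -` C \<inter> space M)))"
          using D WB by (simp add: emeasure_eq_measure sets.Int)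
        also have "?D \<inter> (?W -` C \<inter> space M) = {\<omega> \<in> space M. ?W \<omega> \<in> C \<and> X (t + s) \<omega> - X t \<omega> \<in> B}"
          by auto
        finally show ?thesis .
      qed
      have Q: "emeasure ?Q C = ennreal (prob {\<omega> \<in> space M. ?W \<omega> \<in> C} * prob ?D)"
        if C: "C \<in> sets (path_algebra {0..t})" for C
        using W C by (simp add: emeasure_distr emeasure_eq_measure ennreal_mult'' mult.commute
            vimage_def Int_def conj_commute)
      have "?P = ?Q"
      proof (rule measure_eqI_PiM_infinite)
        fix C :: "real \<Rightarrow> nat set" and J assume J: "finite J" "J \<subseteq> {0..t}"
        let ?C = "prod_emb {0..t} (\<lambda>_. count_space UNIV) J (Pi\<^sub>E J C)"
        have C: "?C \<in> sets (path_algebra {0..t})"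
          using J by (intro sets_PiM_I) auto
        have *: "?W \<omega> \<in> ?C \<longleftrightarrow> (\<forall>u\<in>J. X u \<omega> \<in> C u)" for \<omega>
          using J by (subst prod_emb_PiE) (auto simp: PiE_iff split: if_splits)
        show "emeasure ?P ?C = emeasure ?Q ?C"
          unfolding P[OF C] Q[OF C] * using poisson_increments_cylinder[OF pp t s J] by simp
      next
        show "finite_measure ?P"
          by (rule finite_measureI) (simp add: P)
      qed simp_all
      then have "ennreal (prob {\<omega> \<in> space M. ?W \<omega> \<in> A \<and> X (t + s) \<omega> - X t \<omega> \<in> B}) =
          ennreal (prob {\<omega> \<in> space M. ?W \<omega> \<in> A} * prob ?D)"
        using P[OF A] Q[OF A] by simp
      \<comment> \<open>Stationarity: the increments from \<open>t\<close> and from 0 have the same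
        Poisson law.\<close>
      moreover have "prob ?D = prob {\<omega> \<in> space M. X s \<omega> \<in> B}"
      proof -
        have "{\<omega> \<in> space M. X s \<omega> \<in> B} = {\<omega> \<in> space M. X (0 + s) \<omega> - X 0 \<omega> \<in> B}"
          using X_zero by auto
        then show ?thesis
          using poisson_increment_prob[OF pp t s] poisson_increment_prob[OF pp order_refl s] by simp
      qed
      ultimately show ?thesis by simp
    qed
  qed
qed

subsection \<open>Composition of independent processes\<close>

context prob_space
begin

text \<open>Fubini with an independent copy: the inner integral runs over a second sample point.
  Independence enters as equality of joint law and product law, so \<open>K\<close> and
  \<open>Y\<close> may take values in different types.\<close>

lemma nn_integral_distr_pair:
  assumes K [measurable]: "random_variable S K" and Y [measurable]: "random_variable T Y"
    and eq: "distr M S K \<Otimes>\<^sub>M distr M T Y = distr M (S \<Otimes>\<^sub>M T) (\<lambda>\<omega>. (K \<omega>, Y \<omega>))"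
    and f: "f \<in> borel_measurable (S \<Otimes>\<^sub>M T)"
  shows "(\<integral>\<^sup>+\<omega>. f (K \<omega>, Y \<omega>) \<partial>M) = (\<integral>\<^sup>+\<omega>. \<integral>\<^sup>+\<omega>'. f (K \<omega>, Y \<omega>') \<partial>M \<partial>M)"
proof -
  interpret T: prob_space "distr M T Y" by (rule prob_space_distr) fact
  note f [measurable]
  have "(\<integral>\<^sup>+\<omega>. f (K \<omega>, Y \<omega>) \<partial>M) = (\<integral>\<^sup>+z. f z \<partial>(distr M S K \<Otimes>\<^sub>M distr M T Y))"
    unfolding eq by (subst nn_integral_distr) auto
  also have "\<dots> = (\<integral>\<^sup>+x. \<integral>\<^sup>+y. f (x, y) \<partial>distr M T Y \<partial>distr M S K)"
    by (subst T.nn_integral_fst[symmetric]) (simp_all cong: measurable_cong_sets)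
  also have "\<dots> = (\<integral>\<^sup>+x. \<integral>\<^sup>+\<omega>'. f (x, Y \<omega>') \<partial>M \<partial>distr M S K)"
    by (intro nn_integral_cong, subst nn_integral_distr) auto
  also have "\<dots> = (\<integral>\<^sup>+\<omega>. \<integral>\<^sup>+\<omega>'. f (K \<omega>, Y \<omega>') \<partial>M \<partial>M)"
    by (subst nn_integral_distr) auto
  finally show ?thesis .
qed

lemma emeasure_distr_pair:
  assumes K [measurable]: "random_variable S K" and Y [measurable]: "random_variable T Y"
    and eq: "distr M S K \<Otimes>\<^sub>M distr M T Y = distr M (S \<Otimes>\<^sub>M T) (\<lambda>\<omega>. (K \<omega>, Y \<omega>))"
    and Q: "{p \<in> space (S \<Otimes>\<^sub>M T). Q p} \<in> sets (S \<Otimes>\<^sub>M T)"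
  shows "emeasure M {\<omega> \<in> space M. Q (K \<omega>, Y \<omega>)} =
    (\<integral>\<^sup>+\<omega>. emeasure M {\<omega>' \<in> space M. Q (K \<omega>, Y \<omega>')} \<partial>M)"
proof -
  let ?Q = "{p \<in> space (S \<Otimes>\<^sub>M T). Q p}"
  note Q [measurable]
  have space: "K \<omega> \<in> space S" "Y \<omega> \<in> space T" if "\<omega> \<in> space M" for \<omega>
    using measurable_space[OF K that] measurable_space[OF Y that] by auto
  have sets_Q: "{\<omega>' \<in> space M. Q (f \<omega>')} \<in> sets M"
    if f: "f \<in> measurable M (S \<Otimes>\<^sub>M T)" for f
  proof -
    have "{\<omega>' \<in> space M. Q (f \<omega>')} = f -` ?Q \<inter> space M"
      using measurable_space[OF f] by auto
    then show ?thesis using measurable_sets[OF f Q] by simp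
  qed
  have emeasure_Q: "emeasure M {\<omega>' \<in> space M. Q (f \<omega>')} = (\<integral>\<^sup>+\<omega>'. indicator ?Q (f \<omega>') \<partial>M)"
    if f: "f \<in> measurable M (S \<Otimes>\<^sub>M T)" for f
  proof -
    have "emeasure M {\<omega>' \<in> space M. Q (f \<omega>')} = (\<integral>\<^sup>+\<omega>'. indicator {\<omega>' \<in> space M. Q (f \<omega>')} \<omega>' \<partial>M)"
      by (rule nn_integral_indicator[OF sets_Q[OF f], symmetric])
    also have "\<dots> = (\<integral>\<^sup>+\<omega>'. indicator ?Q (f \<omega>') \<partial>M)"
      using measurable_space[OF f] by (intro nn_integral_cong) (simp add: indicator_def)
    finally show ?thesis .
  qed
  have "emeasure M {\<omega> \<in> space M. Q (K \<omega>, Y \<omega>)} = (\<integral>\<^sup>+\<omega>. indicator ?Q (K \<omega>, Y \<omega>) \<partial>M)"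
    by (rule emeasure_Q) measurable
  also have "\<dots> = (\<integral>\<^sup>+\<omega>. \<integral>\<^sup>+\<omega>'. indicator ?Q (K \<omega>, Y \<omega>') \<partial>M \<partial>M)"
    by (rule nn_integral_distr_pair[OF K Y eq]) (rule borel_measurable_indicator[OF Q])
  also have "\<dots> = (\<integral>\<^sup>+\<omega>. emeasure M {\<omega>' \<in> space M. Q (K \<omega>, Y \<omega>')} \<partial>M)"
    using space by (intro nn_integral_cong emeasure_Q[symmetric]) measurable
  finally show ?thesis .
qed

end

context levy_counting_process
begin

lemma prob_increment:
  assumes "0 \<le> t" "0 \<le> s"
  shows "prob {\<omega> \<in> space M. X (t + s) \<omega> - X t \<omega> \<in> B} = prob {\<omega> \<in> space M. X s \<omega> \<in> B}"
  using increments[OF assms sets.top, of B] by (simp add: space_PiM prob_space)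

text \<open>The locale axiom is the required equality on rectangles, and rectangles determine the
  product measure.\<close>

lemma indep_increments:
  assumes "0 \<le> t" "0 \<le> s"
  shows "distr M (path_algebra {0..t}) (\<lambda>\<omega>. \<lambda>u\<in>{0..t}. X u \<omega>) \<Otimes>\<^sub>M
      distr M (count_space UNIV) (\<lambda>\<omega>. X (t + s) \<omega> - X t \<omega>) =
    distr M (path_algebra {0..t} \<Otimes>\<^sub>M count_space UNIV)
      (\<lambda>\<omega>. (\<lambda>u\<in>{0..t}. X u \<omega>, X (t + s) \<omega> - X t \<omega>))"
proof -
  let ?W = "\<lambda>\<omega>. \<lambda>u\<in>{0..t}. X u \<omega>" and ?D = "\<lambda>\<omega>. X (t + s) \<omega> - X t \<omega>"
  have W: "?W \<in> measurable M (path_algebra {0..t})" by (rule path_measurable)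
  have D: "?D \<in> measurable M (count_space UNIV)" using assms by (intro diff_measurable) auto
  interpret W: prob_space "distr M (path_algebra {0..t}) ?W" by (rule prob_space_distr) fact
  interpret D: prob_space "distr M (count_space UNIV) ?D" by (rule prob_space_distr) fact
  show "distr M (path_algebra {0..t}) ?W \<Otimes>\<^sub>M distr M (count_space UNIV) ?D =
      distr M (path_algebra {0..t} \<Otimes>\<^sub>M count_space UNIV) (\<lambda>\<omega>. (?W \<omega>, ?D \<omega>))"
  proof (rule pair_measure_eqI)
    fix A B assume "A \<in> sets (distr M (path_algebra {0..t}) ?W)" "B \<in> sets (distr M (count_space UNIV) ?D)"
    then have A: "A \<in> sets (path_algebra {0..t})" by simp
    have "(\<lambda>\<omega>. (?W \<omega>, ?D \<omega>)) -` (A \<times> B) \<inter> space M = {\<omega> \<in> space M. ?W \<omega> \<in> A \<and> ?D \<omega> \<in> B}"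
      by auto
    moreover have "?W -` A \<inter> space M = {\<omega> \<in> space M. ?W \<omega> \<in> A}"
      "?D -` B \<inter> space M = {\<omega> \<in> space M. ?D \<omega> \<in> B}" by auto
    moreover have "(\<lambda>\<omega>. (?W \<omega>, ?D \<omega>)) \<in> measurable M (path_algebra {0..t} \<Otimes>\<^sub>M count_space UNIV)"
      using W D by (rule measurable_Pair)
    ultimately show "emeasure (distr M (path_algebra {0..t}) ?W) A * emeasure (distr M (count_space UNIV) ?D) B =
      emeasure (distr M (path_algebra {0..t} \<Otimes>\<^sub>M count_space UNIV) (\<lambda>\<omega>. (?W \<omega>, ?D \<omega>))) (A \<times> B)"
      using W D A increments[OF assms A, of B] prob_increment[OF assms, of B]
      by (simp add: emeasure_distr emeasure_eq_measure ennreal_mult)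
  next
    show "sets (distr M (path_algebra {0..t}) ?W \<Otimes>\<^sub>M distr M (count_space UNIV) ?D) =
        sets (distr M (path_algebra {0..t} \<Otimes>\<^sub>M count_space UNIV) (\<lambda>\<omega>. (?W \<omega>, ?D \<omega>)))"
      unfolding sets_distr by (rule sets_pair_measure_cong) simp_all
  qed (rule W.sigma_finite_measure D.sigma_finite_measure)+
qed

end

text \<open>The random time \<open>fst p u\<close> is a natural number, so evaluating the second
  path there is a countable case distinction.\<close>

lemma measurable_eval_pair:
  assumes "0 \<le> u" "{0..u} \<subseteq> I"
  shows "(\<lambda>p. snd p (real (fst p u))) \<in>
    measurable (path_algebra I \<Otimes>\<^sub>M path_algebra {0..}) (count_space UNIV)"
proof (rule measurable_compose_countable[of "\<lambda>i p. snd p (real i)"])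
  show "(\<lambda>p. snd p (real i)) \<in> measurable (path_algebra I \<Otimes>\<^sub>M path_algebra {0..}) (count_space UNIV)" for i
    by (rule measurable_compose[OF measurable_snd]) (rule measurable_component_singleton, simp)
  show "(\<lambda>p. fst p u) \<in> measurable (path_algebra I \<Otimes>\<^sub>M path_algebra {0..}) (count_space UNIV)"
    using assms by (intro measurable_compose[OF measurable_fst] measurable_component_singleton) auto
qed

locale indep_levy_counting_processes = prob_space M +
  X: levy_counting_process M X + Y: levy_counting_process M Y
  for M :: "'a measure" and X Y :: "real \<Rightarrow> 'a \<Rightarrow> nat" +
  assumes indep: "indep_var (path_algebra {0..}) (\<lambda>\<omega>. \<lambda>u\<in>{0..}. X u \<omega>)
      (path_algebra {0..}) (\<lambda>\<omega>. \<lambda>u\<in>{0..}. Y u \<omega>)"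
begin

lemma compose_counting_process: "counting_process M (\<lambda>t \<omega>. Y (real (X t \<omega>)) \<omega>)"
proof (rule counting_process.intro)
  fix t :: real assume t: "0 \<le> t"
  show "(\<lambda>\<omega>. Y (real (X t \<omega>)) \<omega>) \<in> measurable M (count_space UNIV)"
    by (rule measurable_compose_countable[where f="\<lambda>i \<omega>. Y (real i) \<omega>" and g="X t", OF Y.measurable_X X.measurable_X]) (simp_all add: t)
next
  fix \<omega> and t :: real assume "\<omega> \<in> space M" "0 \<le> t"
  then obtain e where "e > 0" "\<forall>u\<in>{t..<t + e}. X u \<omega> = X t \<omega>"
    using X.X_right_const by blast
  then show "\<exists>e>0. \<forall>u\<in>{t..<t + e}. Y (real (X u \<omega>)) \<omega> = Y (real (X t \<omega>)) \<omega>"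
    by metis
next
  fix \<omega> assume "\<omega> \<in> space M"
  then show "Y (real (X 0 \<omega>)) \<omega> = 0" by (simp add: X.X_zero Y.X_zero)
next
  fix \<omega> and s t :: real assume "\<omega> \<in> space M" "0 \<le> s" "s \<le> t"
  then show "Y (real (X s \<omega>)) \<omega> \<le> Y (real (X t \<omega>)) \<omega>"
    by (intro Y.X_mono) (simp_all add: X.X_mono)
qed

text \<open>Conditioning on \<open>X\<close>: its path is frozen at \<open>\<omega>\<close> while
  \<open>Y\<close> is averaged over \<open>\<omega>'\<close>.\<close>

lemma compose_emeasure:
  assumes "{p \<in> space (path_algebra {0..} \<Otimes>\<^sub>M path_algebra {0..}). Q p}
      \<in> sets (path_algebra {0..} \<Otimes>\<^sub>M path_algebra {0..})"
  shows "emeasure M {\<omega> \<in> space M. Q (\<lambda>u\<in>{0..}. X u \<omega>, \<lambda>u\<in>{0..}. Y u \<omega>)} =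
    (\<integral>\<^sup>+\<omega>. emeasure M {\<omega>' \<in> space M. Q (\<lambda>u\<in>{0..}. X u \<omega>, \<lambda>u\<in>{0..}. Y u \<omega>')} \<partial>M)"
  using indep assms unfolding indep_var_distribution_eq by (elim conjE) (rule emeasure_distr_pair)

text \<open>With \<open>X\<close> frozen, the past of \<open>Z\<close> depends only on
  \<open>Y\<close> up to time \<open>X t\<close>, and its increment is that of \<open>Y\<close> over
  the next \<open>X (t + s) - X t\<close> units. Independence for \<open>Y\<close> factors the
  conditional probability, and independence for \<open>X\<close> then factors its mean.\<close>

lemma compose_increments:
  assumes t: "0 \<le> t" and s: "0 \<le> s" and A: "A \<in> sets (path_algebra {0..t})"
  defines "Z \<equiv> \<lambda>t \<omega>. Y (real (X t \<omega>)) \<omega>"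
  shows "prob {\<omega> \<in> space M. (\<lambda>u\<in>{0..t}. Z u \<omega>) \<in> A \<and> Z (t + s) \<omega> - Z t \<omega> \<in> B} =
    prob {\<omega> \<in> space M. (\<lambda>u\<in>{0..t}. Z u \<omega>) \<in> A} * prob {\<omega> \<in> space M. Z s \<omega> \<in> B}"
proof -
  let ?P = "path_algebra {0..} :: (real \<Rightarrow> nat) measure"
  let ?W = "\<lambda>\<omega>. \<lambda>u\<in>{0..t}. X u \<omega>" and ?D = "\<lambda>\<omega>. X (t + s) \<omega> - X t \<omega>"
  let ?eval = "\<lambda>p. \<lambda>u\<in>{0..t}. snd p (real (fst p u)) :: nat"
  \<comment> \<open>Conditionally on \<open>X\<close>, the past of \<open>Z\<close> and its increment are independent with probabilities
    \<open>h\<close> and \<open>g\<close>, which depend on the past and on the increment of \<open>X\<close>, respectively.\<close>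
  define h where "h x = emeasure M {\<omega>' \<in> space M. (\<lambda>u\<in>{0..t}. Y (real (x u)) \<omega>') \<in> A}" for x :: "real \<Rightarrow> nat"
  define g where "g d = emeasure M {\<omega>' \<in> space M. Y (real d) \<omega>' \<in> B}" for d :: nat
  have eval: "?eval \<in> measurable (path_algebra I \<Otimes>\<^sub>M ?P) (path_algebra {0..t})" if "{0..t} \<subseteq> I" for I
    by (rule measurable_restrict) (use that in \<open>auto intro!: measurable_eval_pair\<close>)
  have evalA: "{p \<in> space (path_algebra I \<Otimes>\<^sub>M ?P). ?eval p \<in> A} \<in> sets (path_algebra I \<Otimes>\<^sub>M ?P)"
    if "{0..t} \<subseteq> I" for I
    using measurable_sets[OF eval[OF that] A] by (simp add: vimage_def Int_def conj_commute)
  have evalD: "{p \<in> space (?P \<Otimes>\<^sub>M ?P). snd p (real (fst p (t + s))) - snd p (real (fst p t)) \<in> B} \<in> sets (?P \<Otimes>\<^sub>M ?P)"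
  proof -
    have "(\<lambda>p. (snd p (real (fst p (t + s))), snd p (real (fst p t)))) \<in>
        measurable (?P \<Otimes>\<^sub>M ?P) (count_space UNIV \<Otimes>\<^sub>M count_space UNIV)"
      using t s by (intro measurable_Pair measurable_eval_pair) auto
    then have "(\<lambda>p. (snd p (real (fst p (t + s))), snd p (real (fst p t)))) \<in> measurable (?P \<Otimes>\<^sub>M ?P) (count_space UNIV)"
      by (simp add: pair_measure_countable)
    from measurable_sets[OF this, of "{(a, b). a - b \<in> B}"] show ?thesis
      by (simp add: vimage_def Int_def conj_commute)
  qed
  have evalB: "{p \<in> space (?P \<Otimes>\<^sub>M ?P). snd p (real (fst p s)) \<in> B} \<in> sets (?P \<Otimes>\<^sub>M ?P)"
  proof -
    have "(\<lambda>p. snd p (real (fst p s))) \<in> measurable (?P \<Otimes>\<^sub>M ?P) (count_space UNIV)"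
      using s by (intro measurable_eval_pair) auto
    from measurable_sets[OF this, of B] show ?thesis
      by (simp add: vimage_def Int_def conj_commute)
  qed
  have YP: "(\<lambda>\<omega>. \<lambda>u\<in>{0..}. Y u \<omega>) \<in> measurable M ?P"
    by (rule measurable_restrict) (auto intro: Y.measurable_X)
  have Yset: "{\<omega>' \<in> space M. (\<lambda>u\<in>{0..t}. Y (real (x u)) \<omega>') \<in> A} \<in> sets M" for x :: "real \<Rightarrow> nat"
  proof -
    have "(\<lambda>\<omega>'. \<lambda>u\<in>{0..t}. Y (real (x u)) \<omega>') \<in> measurable M (path_algebra {0..t})"
      by (rule measurable_restrict) (auto intro: Y.measurable_X)
    from measurable_sets[OF this A] show ?thesis by (simp add: vimage_def Int_def conj_commute)
  qed
  have h_measurable: "h \<in> borel_measurable (path_algebra {0..t})"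
  proof -
    let ?Q = "{p \<in> space (path_algebra {0..t} \<Otimes>\<^sub>M ?P). ?eval p \<in> A}"
    have [measurable]: "?Q \<in> sets (path_algebra {0..t} \<Otimes>\<^sub>M ?P)" by (rule evalA) simp
    note YP [measurable]
    have "(\<lambda>x. \<integral>\<^sup>+\<omega>'. indicator ?Q (x, \<lambda>u\<in>{0..}. Y u \<omega>') \<partial>M) \<in> borel_measurable (path_algebra {0..t})"
      by measurable
    moreover have "(\<integral>\<^sup>+\<omega>'. indicator ?Q (x, \<lambda>u\<in>{0..}. Y u \<omega>') \<partial>M) = h x"
      if "x \<in> space (path_algebra {0..t})" for x
      unfolding h_def using that
      by (subst nn_integral_indicator[OF Yset, symmetric])
        (auto intro!: nn_integral_cong simp: indicator_def space_pair_measure space_PiM cong: restrict_cong)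
    ultimately show ?thesis by (simp cong: measurable_cong)
  qed
  have inner: "emeasure M {\<omega>' \<in> space M. (\<lambda>u\<in>{0..t}. Y (real (X u \<omega>)) \<omega>') \<in> A \<and>
      Y (real (X (t + s) \<omega>)) \<omega>' - Y (real (X t \<omega>)) \<omega>' \<in> B} = h (?W \<omega>) * g (?D \<omega>)"
    if \<omega>: "\<omega> \<in> space M" for \<omega>
  proof -
    let ?R = "\<lambda>y. \<lambda>u\<in>{0..t}. y (real (X u \<omega>)) :: nat"
    \<comment> \<open>The past of \<open>Z\<close> as an event about the path of \<open>Y\<close> on
      \<open>{0..real (X t \<omega>)}\<close>, which is the form that \<open>Y.increments\<close>
      expects.\<close>
    let ?A = "{y \<in> space (path_algebra {0..real (X t \<omega>)}). ?R y \<in> A}"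
    have le: "X u \<omega> \<le> X t \<omega>" if "u \<in> {0..t}" for u
      using that by (intro X.X_mono[OF \<omega>]) auto
    have "?R \<in> measurable (path_algebra {0..real (X t \<omega>)}) (path_algebra {0..t})"
      by (rule measurable_restrict) (auto intro!: measurable_component_singleton le)
    from measurable_sets[OF this A]
    have A': "?A \<in> sets (path_algebra {0..real (X t \<omega>)})"
      by (simp add: vimage_def Int_def conj_commute)
    have *: "(\<lambda>v\<in>{0..real (X t \<omega>)}. Y v \<omega>') \<in> ?A \<longleftrightarrow> (\<lambda>u\<in>{0..t}. Y (real (X u \<omega>)) \<omega>') \<in> A" for \<omega>'
      using le by (simp add: space_PiM cong: restrict_cong)
    have sum: "real (X t \<omega>) + real (?D \<omega>) = real (X (t + s) \<omega>)"
      using X.X_mono[OF \<omega>, of t "t + s"] t s by simp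
    have "prob {\<omega>' \<in> space M. (\<lambda>u\<in>{0..t}. Y (real (X u \<omega>)) \<omega>') \<in> A \<and>
        Y (real (X (t + s) \<omega>)) \<omega>' - Y (real (X t \<omega>)) \<omega>' \<in> B} =
      prob {\<omega>' \<in> space M. (\<lambda>u\<in>{0..t}. Y (real (X u \<omega>)) \<omega>') \<in> A} * prob {\<omega>' \<in> space M. Y (real (?D \<omega>)) \<omega>' \<in> B}"
      using Y.increments[OF _ _ A', of "real (?D \<omega>)" B] unfolding * sum by simp
    moreover have "{\<omega>' \<in> space M. (\<lambda>u\<in>{0..t}. Y (real (?W \<omega> u)) \<omega>') \<in> A} =
        {\<omega>' \<in> space M. (\<lambda>u\<in>{0..t}. Y (real (X u \<omega>)) \<omega>') \<in> A}"
      by (simp cong: restrict_cong)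
    ultimately show ?thesis
      unfolding h_def g_def by (simp add: emeasure_eq_measure ennreal_mult)
  qed
  have g_measurable: "g \<in> borel_measurable (count_space UNIV)" by simp
  have "emeasure M {\<omega> \<in> space M. (\<lambda>u\<in>{0..t}. Z u \<omega>) \<in> A \<and> Z (t + s) \<omega> - Z t \<omega> \<in> B} =
      (\<integral>\<^sup>+\<omega>. emeasure M {\<omega>' \<in> space M. (\<lambda>u\<in>{0..t}. Y (real (X u \<omega>)) \<omega>') \<in> A \<and>
        Y (real (X (t + s) \<omega>)) \<omega>' - Y (real (X t \<omega>)) \<omega>' \<in> B} \<partial>M)"
    using compose_emeasure[of "\<lambda>p. ?eval p \<in> A \<and> snd p (real (fst p (t + s))) - snd p (real (fst p t)) \<in> B"]
      sets.sets_Collect_conj[OF evalD evalA[of "{0..}"]] t s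
    by (simp add: Z_def cong: restrict_cong)
  also have "\<dots> = (\<integral>\<^sup>+\<omega>. h (?W \<omega>) * g (?D \<omega>) \<partial>M)"
    by (rule nn_integral_cong) (rule inner)
  also have "\<dots> = (\<integral>\<^sup>+\<omega>. \<integral>\<^sup>+\<omega>'. h (?W \<omega>) * g (?D \<omega>') \<partial>M \<partial>M)"
  proof -
    have D: "?D \<in> measurable M (count_space UNIV)"
      using t s by (intro X.diff_measurable) auto
    have "(\<lambda>p. h (fst p) * g (snd p)) \<in> borel_measurable (path_algebra {0..t} \<Otimes>\<^sub>M count_space UNIV)"
      by (intro borel_measurable_times_ennreal measurable_compose[OF measurable_fst h_measurable]
        measurable_compose[OF measurable_snd g_measurable])
    from nn_integral_distr_pair[OF X.path_measurable D X.indep_increments[OF t s] this]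
    show ?thesis by (simp only: fst_conv snd_conv)
  qed
  also have "\<dots> = (\<integral>\<^sup>+\<omega>. h (?W \<omega>) \<partial>M) * (\<integral>\<^sup>+\<omega>'. g (?D \<omega>') \<partial>M)"
  proof -
    have gD: "(\<lambda>\<omega>. g (?D \<omega>)) \<in> borel_measurable M"
      using t s by (intro measurable_compose[OF _ g_measurable] X.diff_measurable) auto
    have hW: "(\<lambda>\<omega>. h (?W \<omega>)) \<in> borel_measurable M"
      by (rule measurable_compose[OF X.path_measurable h_measurable])
    show ?thesis unfolding nn_integral_cmult[OF gD] nn_integral_multc[OF hW] ..
  qed
  also have "(\<integral>\<^sup>+\<omega>. h (?W \<omega>) \<partial>M) = emeasure M {\<omega> \<in> space M. (\<lambda>u\<in>{0..t}. Z u \<omega>) \<in> A}"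
    using compose_emeasure[of "\<lambda>p. ?eval p \<in> A"] evalA[of "{0..}"] t
    by (simp add: Z_def h_def cong: restrict_cong)
  also have "(\<integral>\<^sup>+\<omega>'. g (?D \<omega>') \<partial>M) = emeasure M {\<omega> \<in> space M. Z s \<omega> \<in> B}"
  proof -
    have D: "?D \<in> measurable M (count_space UNIV)" and Xs: "X s \<in> measurable M (count_space UNIV)"
      using t s by (auto intro!: X.diff_measurable X.measurable_X)
    \<comment> \<open>By stationarity \<open>?D\<close> may be replaced by \<open>X s\<close> under
      the integral, and averaging \<open>g\<close> over \<open>X s\<close> gives the law of
      \<open>Z s\<close>.\<close>
    have "distr M (count_space UNIV) ?D = distr M (count_space UNIV) (X s)"
    proof (rule measure_eqI)
      fix C assume "C \<in> sets (distr M (count_space UNIV) ?D)"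
      show "emeasure (distr M (count_space UNIV) ?D) C = emeasure (distr M (count_space UNIV) (X s)) C"
        using D Xs X.prob_increment[OF t s, of C]
        by (simp add: emeasure_distr emeasure_eq_measure vimage_def Int_def conj_commute)
    qed simp
    then have "(\<integral>\<^sup>+\<omega>'. g (?D \<omega>') \<partial>M) = (\<integral>\<^sup>+\<omega>'. g (X s \<omega>') \<partial>M)"
      using nn_integral_distr[OF D, of g] nn_integral_distr[OF Xs, of g] by simp
    also have "\<dots> = emeasure M {\<omega> \<in> space M. Z s \<omega> \<in> B}"
      using compose_emeasure[of "\<lambda>p. snd p (real (fst p s)) \<in> B"] evalB s
      by (simp add: Z_def g_def)
    finally show ?thesis .
  qed
  finally show ?thesis
    unfolding emeasure_eq_measure ennreal_mult[OF measure_nonneg measure_nonneg, symmetric]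
    by (subst (asm) ennreal_inj) (simp_all only: measure_nonneg mult_nonneg_nonneg)
qed

lemma compose_levy_counting_process: "levy_counting_process M (\<lambda>t \<omega>. Y (real (X t \<omega>)) \<omega>)"
proof (rule levy_counting_process.intro)
  show "prob_space M" by (rule prob_space_axioms)
  show "counting_process M (\<lambda>t \<omega>. Y (real (X t \<omega>)) \<omega>)" by (rule compose_counting_process)
  show "levy_counting_process_axioms M (\<lambda>t \<omega>. Y (real (X t \<omega>)) \<omega>)"
    by (rule levy_counting_process_axioms.intro) (rule compose_increments)
qed

end

subsection \<open>Iterated Poisson processes\<close>

lemma (in indep_levy_counting_processes) compose_power_nn_integral:
  fixes u :: real
  assumes s: "0 \<le> s"
  shows "(\<integral>\<^sup>+\<omega>. ennreal (u ^ Y (real (X s \<omega>)) \<omega>) \<partial>M) =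
    (\<integral>\<^sup>+\<omega>. \<integral>\<^sup>+\<omega>'. ennreal (u ^ Y (real (X s \<omega>)) \<omega>') \<partial>M \<partial>M)"
proof -
  have "(\<lambda>p. snd p (real (fst p s))) \<in>
      measurable (path_algebra {0..} \<Otimes>\<^sub>M path_algebra {0..}) (count_space UNIV)"
    using s by (intro measurable_eval_pair) auto
  then have "(\<lambda>p. ennreal (u ^ snd p (real (fst p s)))) \<in>
      borel_measurable (path_algebra {0..} \<Otimes>\<^sub>M path_algebra {0..})"
    by (rule measurable_compose) simp
  from indep[unfolded indep_var_distribution_eq] this show ?thesis
    using s by (elim conjE) (drule nn_integral_distr_pair, assumption+, simp)
qed

text \<open>The exponential series at \<open>rate * u\<close>, multiplied by
  \<open>exp (- rate)\<close>.\<close>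

lemma poisson_pmf_nn_integral_power:
  fixes u :: real
  assumes "0 < rate" "0 \<le> u"
  shows "(\<integral>\<^sup>+k. ennreal (u ^ k) \<partial>measure_pmf (poisson_pmf rate)) = ennreal (exp (- rate * (1 - u)))"
proof -
  have sums: "(\<lambda>k. exp (- rate) * ((rate * u) ^ k /\<^sub>R fact k)) sums (exp (- rate) * exp (rate * u))"
    by (intro sums_mult exp_converges)
  have "(\<integral>\<^sup>+k. ennreal (u ^ k) \<partial>measure_pmf (poisson_pmf rate)) =
      (\<Sum>k. ennreal (pmf (poisson_pmf rate) k) * ennreal (u ^ k))"
    by (simp add: nn_integral_measure_pmf nn_integral_count_space_nat)
  also have "\<dots> = (\<Sum>k. ennreal (exp (- rate) * ((rate * u) ^ k /\<^sub>R fact k)))"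
    using assms
    by (intro suminf_cong)
      (simp add: pmf_poisson ennreal_mult[symmetric] power_mult_distrib field_simps)
  also have "\<dots> = ennreal (exp (- rate) * exp (rate * u))"
    using sums assms by (subst suminf_ennreal2) (auto simp: sums_iff)
  also have "exp (- rate) * exp (rate * u) = exp (- rate * (1 - u))"
    by (simp add: exp_add[symmetric] algebra_simps)
  finally show ?thesis .
qed

lemma (in prob_space) poisson_process_nn_integral_power:
  fixes u :: real
  assumes pp: "poisson_process M lam X" and "0 < lam" "0 \<le> s" "0 \<le> u"
  shows "(\<integral>\<^sup>+\<omega>. ennreal (u ^ X s \<omega>) \<partial>M) = ennreal (exp (- lam * s * (1 - u)))"
proof -
  interpret counting_process M X by (rule poisson_counting_process) fact
  show ?thesis
  proof (cases "s = 0")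
    case True
    then have "(\<integral>\<^sup>+\<omega>. ennreal (u ^ X s \<omega>) \<partial>M) = (\<integral>\<^sup>+\<omega>. 1 \<partial>M)"
      by (intro nn_integral_cong) (simp add: X_zero)
    then show ?thesis using True by (simp add: emeasure_space_1)
  next
    case False
    with \<open>0 \<le> s\<close> have s: "0 < s" by simp
    have Xs: "X s \<in> measurable M (count_space UNIV)" by (rule measurable_X) fact
    have "distr M (count_space UNIV) (X s) = distr M (count_space UNIV) (\<lambda>\<omega>. X (0 + s) \<omega> - X 0 \<omega>)"
      by (rule distr_cong) (auto simp: X_zero)
    also have "\<dots> = measure_pmf (poisson_pmf (lam * s))"
      using pp s unfolding poisson_process_def by blast
    finally have "(\<integral>\<^sup>+k. ennreal (u ^ k) \<partial>distr M (count_space UNIV) (X s)) =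
        ennreal (exp (- (lam * s) * (1 - u)))"
      using poisson_pmf_nn_integral_power[of "lam * s" u] assms s by simp
    then show ?thesis using Xs by (simp add: nn_integral_distr)
  qed
qed

section \<open>The iterated process as a functional of independent paths\<close>

lemma measurable_path_family_eval:
  assumes "i \<in> I" "0 \<le> t"
  shows "(\<lambda>p. p i t) \<in> measurable (\<Pi>\<^sub>M _\<in>I. path_algebra {0..}) (count_space UNIV)"
proof (rule measurable_compose[where f="\<lambda>p. p i" and g="\<lambda>x. x t"])
  show "(\<lambda>p. p i) \<in> measurable (\<Pi>\<^sub>M _\<in>I. path_algebra {0..}) (path_algebra {0..})"
    by (rule measurable_component_singleton) fact
  show "(\<lambda>x. x t) \<in> measurable (path_algebra {0..}) (count_space UNIV)"
    using assms(2) by (intro measurable_component_singleton) simp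
qed

text \<open>
  The family \<open>\<lambda>i t p. p i t\<close> is the canonical one on the product of path spaces, so that \<open>mipp\<close>
  applied to it is a measurable functional of the paths of the underlying processes.
\<close>

lemma mipp_path_measurable:
  assumes "m < k" "0 \<le> t"
  shows "mipp (\<lambda>i t p. p i t) (Suc m) t \<in>
    measurable (\<Pi>\<^sub>M _\<in>{1..k}. path_algebra {0..}) (count_space UNIV)"
  using assms(1)
proof (induction m)
  case 0
  have "mipp (\<lambda>i t p. p i t) (Suc 0) t = (\<lambda>p. p (Suc 0) t)" by (intro ext) simp
  then show ?case using measurable_path_family_eval[of "Suc 0" "{1..k}" t] 0 assms(2) by simp
next
  case (Suc m)
  have "mipp (\<lambda>i t p. p i t) (Suc (Suc m)) t =
      (\<lambda>p. p (Suc (Suc m)) (real (mipp (\<lambda>i t p. p i t) (Suc m) t p)))"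
    by (intro ext) simp
  also have "\<dots> \<in> measurable (\<Pi>\<^sub>M _\<in>{1..k}. path_algebra {0..}) (count_space UNIV)"
    using Suc.prems
    by (intro measurable_compose_countable[where f="\<lambda>i p. p (Suc (Suc m)) (real i)", OF _ Suc.IH]
        measurable_path_family_eval) auto
  finally show ?case .
qed

lemma mipp_path:
  assumes "m < k" "0 \<le> t"
  shows "mipp (\<lambda>i t p. p i t) (Suc m) t (\<lambda>i\<in>{1..k}. \<lambda>t\<in>{0..}. N i t \<omega>) = mipp N (Suc m) t \<omega>"
  using assms by (induction m) auto

text \<open>The iterate is a measurable functional of the first \<open>m + 1\<close> processes, and
  the disjoint blocks \<open>{1..Suc m}\<close> and \<open>{Suc (Suc m)}\<close> of the family are
  independent.\<close>

lemma (in prob_space) mipp_indep_path: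
  assumes "indep_processes M N"
  shows "indep_var (path_algebra {0..}) (\<lambda>\<omega>. \<lambda>t\<in>{0..}. mipp N (Suc m) t \<omega>)
    (path_algebra {0..}) (\<lambda>\<omega>. \<lambda>t\<in>{0..}. N (Suc (Suc m)) t \<omega>)"
proof -
  let ?\<Phi> = "\<lambda>p. \<lambda>t\<in>{0..}. mipp (\<lambda>i t p. p i t) (Suc m) t p"
  let ?K = "\<lambda>I \<omega>. \<lambda>i\<in>I. \<lambda>t\<in>{0..}. N i t \<omega>"
  have "indep_var (\<Pi>\<^sub>M _\<in>{1..Suc m}. path_algebra {0..}) (?K {1..Suc m})
      (\<Pi>\<^sub>M _\<in>{Suc (Suc m)}. path_algebra {0..}) (?K {Suc (Suc m)})"
    using assms unfolding indep_processes_def by (rule indep_var_restrict) auto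
  moreover have "?\<Phi> \<in> measurable (\<Pi>\<^sub>M _\<in>{1..Suc m}. path_algebra {0..}) (path_algebra {0..})"
    by (rule measurable_restrict) (rule mipp_path_measurable, auto)
  moreover have "(\<lambda>p. p (Suc (Suc m))) \<in> measurable (\<Pi>\<^sub>M _\<in>{Suc (Suc m)}. path_algebra {0..}) (path_algebra {0..})"
    by (rule measurable_component_singleton) simp
  ultimately have "indep_var (path_algebra {0..}) (?\<Phi> \<circ> ?K {1..Suc m})
      (path_algebra {0..}) ((\<lambda>p. p (Suc (Suc m))) \<circ> ?K {Suc (Suc m)})"
    by (rule indep_var_compose)
  also have "?\<Phi> \<circ> ?K {1..Suc m} = (\<lambda>\<omega>. \<lambda>t\<in>{0..}. mipp N (Suc m) t \<omega>)"
    unfolding comp_def by (intro ext restrict_ext mipp_path) auto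
  also have "(\<lambda>p. p (Suc (Suc m))) \<circ> ?K {Suc (Suc m)} = (\<lambda>\<omega>. \<lambda>t\<in>{0..}. N (Suc (Suc m)) t \<omega>)"
    by (simp add: comp_def)
  finally show ?thesis .
qed

locale iterated_poisson = prob_space M
  for M :: "'a measure" and N :: "nat \<Rightarrow> real \<Rightarrow> 'a \<Rightarrow> nat" and lam :: real +
  assumes lam_pos: "0 < lam"
    and poisson: "1 \<le> i \<Longrightarrow> poisson_process M lam (N i)"
    and indep: "indep_processes M N"
begin

text \<open>The function \<phi> of the overview: the generating function of a Poisson variable with
  mean \<open>lam\<close>, hence of \<open>N i 1\<close>.\<close>

definition poisson_pgf :: "real \<Rightarrow> real" where
  "poisson_pgf u = exp (- lam * (1 - u))"

lemma mipp_Suc_Suc: "mipp N (Suc (Suc m)) = (\<lambda>t \<omega>. N (Suc (Suc m)) (real (mipp N (Suc m) t \<omega>)) \<omega>)"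
  by (intro ext) simp

lemma mipp_levy_counting_process: "levy_counting_process M (mipp N (Suc m))"
proof (induction m)
  case 0
  have "mipp N (Suc 0) = N (Suc 0)" by (intro ext) simp
  then show ?case using poisson_levy_counting_process[OF poisson, of "Suc 0"] by simp
next
  case (Suc m)
  interpret indep_levy_counting_processes M "mipp N (Suc m)" "N (Suc (Suc m))"
    by (intro indep_levy_counting_processes.intro indep_levy_counting_processes_axioms.intro
      prob_space_axioms Suc poisson_levy_counting_process[OF poisson] mipp_indep_path indep) simp
  show ?case unfolding mipp_Suc_Suc by (rule compose_levy_counting_process)
qed

text \<open>Given that the inner process equals \<open>k\<close>, the outermost one contributes
  \<open>poisson_pgf u ^ k\<close>. One more iteration thus replaces \<open>u\<close> by
  \<open>poisson_pgf u\<close>, which is why the induction keeps \<open>u\<close> arbitrary.\<close>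

lemma mipp_nn_integral_power:
  assumes "0 \<le> s" "0 \<le> u"
  shows "(\<integral>\<^sup>+\<omega>. ennreal (u ^ mipp N (Suc m) s \<omega>) \<partial>M) = ennreal (exp (- lam * s * (1 - (poisson_pgf ^^ m) u)))"
  using assms(2)
proof (induction m arbitrary: u)
  case 0
  then show ?case using poisson_process_nn_integral_power[OF poisson lam_pos, of "Suc 0" s u] assms by simp
next
  case (Suc m)
  interpret indep_levy_counting_processes M "mipp N (Suc m)" "N (Suc (Suc m))"
    by (intro indep_levy_counting_processes.intro indep_levy_counting_processes_axioms.intro
      prob_space_axioms mipp_levy_counting_process poisson_levy_counting_process[OF poisson] mipp_indep_path indep) simp
  have inner: "(\<integral>\<^sup>+\<omega>. ennreal (u ^ N (Suc (Suc m)) (real k) \<omega>) \<partial>M) = ennreal (poisson_pgf u ^ k)" for k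
    using poisson_process_nn_integral_power[OF poisson lam_pos, of "Suc (Suc m)" "real k" u] Suc.prems
    by (simp add: poisson_pgf_def exp_of_nat_mult[symmetric] mult.commute mult.left_commute)
  have "(\<integral>\<^sup>+\<omega>. ennreal (u ^ mipp N (Suc (Suc m)) s \<omega>) \<partial>M) =
      (\<integral>\<^sup>+\<omega>. ennreal (poisson_pgf u ^ mipp N (Suc m) s \<omega>) \<partial>M)"
    unfolding mipp_Suc_Suc compose_power_nn_integral[OF assms(1)] inner ..
  also have "\<dots> = ennreal (exp (- lam * s * (1 - (poisson_pgf ^^ m) (poisson_pgf u))))"
    by (rule Suc.IH) (simp add: poisson_pgf_def)
  finally show ?case by (simp add: funpow_Suc_right del: funpow.simps)
qed

lemma prob_mipp_eq_0:
  assumes s: "0 \<le> s"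
  shows "prob {\<omega> \<in> space M. mipp N (Suc m) s \<omega> = 0} = exp (- lam * s * (1 - (poisson_pgf ^^ m) 0))"
proof -
  interpret levy_counting_process M "mipp N (Suc m)" by (rule mipp_levy_counting_process)
  have "{\<omega> \<in> space M. mipp N (Suc m) s \<omega> = 0} = mipp N (Suc m) s -` {0} \<inter> space M" by auto
  then have ev: "{\<omega> \<in> space M. mipp N (Suc m) s \<omega> = 0} \<in> events"
    using measurable_sets[OF measurable_X[OF s], of "{0}"] by simp
  have "ennreal (prob {\<omega> \<in> space M. mipp N (Suc m) s \<omega> = 0}) =
      (\<integral>\<^sup>+\<omega>. indicator {\<omega> \<in> space M. mipp N (Suc m) s \<omega> = 0} \<omega> \<partial>M)"
    using ev by (simp only: nn_integral_indicator emeasure_eq_measure)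
  \<comment> \<open>Since \<open>0 ^ 0 = 1\<close>, the power \<open>0 ^ k\<close> is the indicator
    of \<open>k = 0\<close>.\<close>
  also have "\<dots> = (\<integral>\<^sup>+\<omega>. ennreal (0 ^ mipp N (Suc m) s \<omega>) \<partial>M)"
    by (intro nn_integral_cong) (auto simp: indicator_def power_0_left)
  also have "\<dots> = ennreal (exp (- lam * s * (1 - (poisson_pgf ^^ m) 0)))"
    by (rule mipp_nn_integral_power[OF s]) simp
  finally show ?thesis by simp
qed

text \<open>At time 1 the probability of the value 0 is itself one further application of
  \<open>poisson_pgf\<close>, hence the exponent \<open>Suc m\<close>.\<close>

lemma mipp_pos_prob_Suc: "mipp_pos_prob M N (Suc m) = 1 - (poisson_pgf ^^ Suc m) 0"
proof -
  interpret levy_counting_process M "mipp N (Suc m)" by (rule mipp_levy_counting_process)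
  have "{\<omega> \<in> space M. mipp N (Suc m) 1 \<omega> = 0} = mipp N (Suc m) 1 -` {0} \<inter> space M" by auto
  then have "{\<omega> \<in> space M. mipp N (Suc m) 1 \<omega> = 0} \<in> events"
    using measurable_sets[OF measurable_X, of 1 "{0}"] by simp
  moreover have "{\<omega> \<in> space M. mipp N (Suc m) 1 \<omega> > 0} =
      space M - {\<omega> \<in> space M. mipp N (Suc m) 1 \<omega> = 0}" by auto
  ultimately show ?thesis
    using prob_mipp_eq_0[of 1 m] by (simp add: mipp_pos_prob_def prob_compl poisson_pgf_def del: mipp.simps)
qed

text \<open>Makes the rate of the exponential law strictly positive.\<close>

lemma poisson_pgf_funpow_less_1: "(poisson_pgf ^^ m) 0 < 1"
  using lam_pos by (induction m) (auto simp: poisson_pgf_def mult_pos_pos)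

end

theorem proposition2p5:
  fixes M :: "'a measure" and N :: "nat \<Rightarrow> real \<Rightarrow> 'a \<Rightarrow> nat" and lam :: real and n :: nat
  assumes "prob_space M"
    and "lam > 0"
    and "n \<ge> 2"
    and "\<And>i. i \<ge> 1 \<Longrightarrow> poisson_process M lam (N i)"
    and "indep_processes M N"
  shows "prob_space.indep_vars M (\<lambda>_. borel) (\<lambda>k. sojourn_time (mipp N n) k) {1..}
    \<and> (\<forall>k\<ge>1. distr M borel (sojourn_time (mipp N n) k)
             = exponential_law (lam * mipp_pos_prob M N (n - 1)))
    \<and> (\<forall>j\<ge>2. mipp_pos_prob M N j = 1 - exp (- lam * mipp_pos_prob M N (j - 1)))
    \<and> mipp_pos_prob M N 1 = 1 - exp (- lam)"
proof -
  interpret iterated_poisson M N lam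
    by (intro iterated_poisson.intro iterated_poisson_axioms.intro assms)
  have Suc_Suc: "\<exists>i. j = Suc (Suc i)" if "j \<ge> 2" for j :: nat
    using that by presburger
  then obtain m where m: "n = Suc (Suc m)" using \<open>n \<ge> 2\<close> by blast
  interpret levy_counting_process M "mipp N n" unfolding m by (rule mipp_levy_counting_process)
  let ?r = "lam * mipp_pos_prob M N (n - 1)"
  \<comment> \<open>For \<open>n = Suc (Suc m)\<close> the exponent contains the iterate of order
    \<open>Suc m = n - 1\<close> at 0, and one minus this iterate is the positivity probability of
    order \<open>n - 1\<close>.\<close>
  have r: "prob {\<omega> \<in> space M. mipp N n s \<omega> = 0} = exp (- ?r * s)" if "0 \<le> s" for s
    using prob_mipp_eq_0[OF that, of "Suc m"]
    by (simp add: m mipp_pos_prob_Suc mult.commute mult.left_commute del: mipp.simps funpow.simps)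
  have "0 < ?r"
    using lam_pos poisson_pgf_funpow_less_1[of "Suc m"] by (simp add: m mipp_pos_prob_Suc del: funpow.simps)
  have "mipp_pos_prob M N j = 1 - exp (- lam * mipp_pos_prob M N (j - 1))" if "j \<ge> 2" for j
  proof -
    obtain i where "j = Suc (Suc i)" using Suc_Suc \<open>j \<ge> 2\<close> by blast
    then show ?thesis by (simp add: mipp_pos_prob_Suc poisson_pgf_def)
  qed
  moreover have "mipp_pos_prob M N 1 = 1 - exp (- lam)"
    using mipp_pos_prob_Suc[of 0] by (simp add: poisson_pgf_def)
  moreover have "indep_vars (\<lambda>_. borel) (\<lambda>k. sojourn_time (mipp N n) k) {1..}"
    using r \<open>0 < ?r\<close> by (rule indep_sojourn_times)
  moreover have "distr M borel (sojourn_time (mipp N n) k) = exponential_law ?r" if "1 \<le> k" for k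
    using r \<open>0 < ?r\<close> that by (rule distr_sojourn_time)
  ultimately show ?thesis by blast
qed

end
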